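(* Let $n\ge2$, $1\le k \le n-1$, $\tau\in[0,1]$. Let $Y_j$ be a spherical harmonic of even degree $j$ on $S^n$ and let $\hat Y_j$ be the Stiefel harmonic induced by $Y_j$, $$\hat Y_j (v)= \varkappa_j \sqrt {d_n(j)}\int_{S^n} Y_j (x)\, R^{(\rho, \sigma)}_{j/2} (2|x^T v|^2-1)\, d_*x,\qquad v\in V_{n+1,n-k},$$ where $\rho=(k-1)/2$, $\sigma=(n-k)/2-1$. Then, for $x\in S^n$, $$(M^*_\tau \hat Y_j)(x)= \hat m_\tau(j)\,Y_j (x),\qquad \hat m_\tau (j)= \frac{\varkappa_j}{\sqrt {d_n(j)}}\, R^{(\rho,\sigma)}_{j/2} (2\tau^2 -1).$$
   Context: $S^n\subset\mathbb{R}^{n+1}$ is the unit sphere, $d_*x$ its normalized (probability) surface measure, $\sigma_m=2\pi^{(m+1)/2}/\Gamma((m+1)/2)$ the area of $S^m$ (so $\sigma_0=2$; note $\sigma$ without index is a real parameter). $V_{n+1,n-k}$ is the Stiefel manifold of real $(n+1)\times(n-k)$ matrices $v$ with $v^Tv=I_{n-k}$. For $x\in S^n$ (a column vector), $|x^Tv|$ is the Euclidean norm of the row vector $x^Tv$. Dual bispherical mean: let $v_0=\begin{bmatrix}0\\ I_{n-k}\end{bmatrix}\in V_{n+1,n-k}$; $K=SO(n)$ the stabilizer of $e_{n+1}$ in $SO(n+1)$; $K'=SO(n-k)\times SO(k+1)$, where $SO(k+1)$ acts on $\mathrm{span}(e_1,\dots,e_{k+1})$ and $SO(n-k)$ acts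 on $\mathrm{span}(e_{k+2},\dots,e_{n+1})$. Let $g_{k+1,n+1}(\theta)$ be the rotation in the plane $(e_{k+1},e_{n+1})$ (identity on the orthogonal complement) with matrix $\begin{bmatrix}\cos\theta&\sin\theta\\-\sin\theta&\cos\theta\end{bmatrix}$, so that $g_{k+1,n+1}(\theta)e_{n+1}=e_{n+1}\cos\theta+e_{k+1}\sin\theta$. For $x\in S^n$ let $r_x$ be a rotation with $r_xe_{n+1}=x$. For $\tau=\cos\theta$, $\theta\in[0,\pi/2]$, and a function $\varphi$ on $V_{n+1,n-k}$, $$(M^*_\tau\varphi)(x)=\int_{K'\times K}\varphi\big(r_x\,\delta^{-1}[g_{k+1,n+1}(\theta)]^{-1}\gamma^{-1}v_0\big)\,d\gamma\,d\delta,$$ with respect to Haar probability measures. Constants and polynomials: $d_n(j)=(n+2j-1)\dfrac{\Gamma(n+j-1)}{\Gamma(j+1)\Gamma(n)}$ is the dimension of the space of spherical harmonics of degree $j$ on $S^n$; $R^{(\rho,\sigma)}_m(t)=P^{(\rho,\sigma)}_m(t)/P^{(\rho,\sigma)}_m(1)$ is the normalized Jacobi polynomial; for $j$ even, $$\varkappa_j=\left[\frac{\sigma_n\,(2j+n-1)\,\Gamma\left(\frac{j+k+1}{2}\right)\Gamma\left(\frac{j+n-1}{2}\right)}{\sigma_{n-k-1}\sigma_k\,\Gamma^2\left(\frac{k+1}{2}\right)\Gamma\left(\frac j2+1\right)\Gamma\left(\frac{j+n-k}{2}\right)}\right]^{1/2}.$$ *)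

theory Defs
  imports "HOL-Probability.Probability"
begin

text \<open>
  The space of real \<open>n+1\<close>-vectors is \<open>real ^ 'm\<close>, and real \<open>(n+1) \<times> (n-k)\<close> matrices are
  \<open>real ^ 'l ^ 'm\<close>.  The bijections \<open>r\<close> from \<open>{1..n+1}\<close> to \<open>'m\<close> and \<open>c\<close> from \<open>{1..n-k}\<close> to \<open>'l\<close>
  (which force \<open>CARD('m) = n+1\<close> and \<open>CARD('l) = n-k\<close>) number the coordinates, so \<open>r i\<close> is the
  \<open>i\<close>-th row index and \<open>c i\<close> the \<open>i\<close>-th column index.
\<close>

definition unit_vec :: "(nat \<Rightarrow> 'm::finite) \<Rightarrow> nat \<Rightarrow> real ^ 'm" where
  "unit_vec r i = axis (r i) 1"

text \<open>
  Normalized surface measure: the radial projection \<open>sgn x = x / norm x\<close> of the uniform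
  distribution on the unit ball.  Restricting the space to the sphere makes integrals independent
  of the values of the integrand off the sphere.
\<close>

definition sphere_measure :: "(real ^ 'm::finite) measure" where
  "sphere_measure =
     restrict_space (distr (uniform_measure lborel (ball 0 1)) borel sgn) (sphere 0 1)"

definition stiefel_manifold :: "(real ^ 'l::finite ^ 'm::finite) set" where
  "stiefel_manifold = {v. transpose v ** v = mat 1}"

definition laplacian :: "('a::euclidean_space \<Rightarrow> 'b::real_normed_vector) \<Rightarrow> 'a \<Rightarrow> 'b" where
  "laplacian p x = (\<Sum>b\<in>Basis.
     vector_derivative (\<lambda>s. vector_derivative (\<lambda>t. p (x + t *\<^sub>R b)) (at s)) (at 0))"

text \<open>
  Spherical harmonics of degree \<open>j\<close>: restrictions to the sphere of (complex-valued) harmonic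
  homogeneous polynomials of degree \<open>j\<close>; only the values of \<open>Y\<close> on the sphere matter.
\<close>

definition spherical_harmonic :: "nat \<Rightarrow> (real ^ 'm::finite \<Rightarrow> complex) \<Rightarrow> bool" where
  "spherical_harmonic j Y \<longleftrightarrow>
     (\<exists>p. polynomial_function p \<and>
          (\<forall>a x. p (a *\<^sub>R x) = a ^ j *\<^sub>R p x) \<and>
          (\<forall>x. laplacian p x = 0) \<and>
          (\<forall>x\<in>sphere 0 1. Y x = p x))"

text \<open>Jacobi polynomials (Szego, Orthogonal Polynomials, (4.3.2)).\<close>

definition jacobi_P :: "real \<Rightarrow> real \<Rightarrow> nat \<Rightarrow> real \<Rightarrow> real" where
  "jacobi_P \<rho> \<sigma> m t =
     (\<Sum>s\<le>m. ((real m + \<rho>) gchoose (m - s)) * ((real m + \<sigma>) gchoose s) *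
            ((t - 1) / 2) ^ s * ((t + 1) / 2) ^ (m - s))"

definition jacobi_R :: "real \<Rightarrow> real \<Rightarrow> nat \<Rightarrow> real \<Rightarrow> real" where
  "jacobi_R \<rho> \<sigma> m t = jacobi_P \<rho> \<sigma> m t / jacobi_P \<rho> \<sigma> m 1"

definition sphere_area :: "nat \<Rightarrow> real" where
  "sphere_area m = 2 * pi powr ((real m + 1) / 2) / Gamma ((real m + 1) / 2)"

definition harmonics_dim :: "nat \<Rightarrow> nat \<Rightarrow> real" where
  "harmonics_dim n j =
     (real n + 2 * real j - 1) * Gamma (real n + real j - 1) / (Gamma (real j + 1) * Gamma (real n))"

definition varkappa :: "nat \<Rightarrow> nat \<Rightarrow> nat \<Rightarrow> real" where
  "varkappa n k j = sqrt
     ((sphere_area n * (2 * real j + real n - 1) *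
         Gamma ((real j + real k + 1) / 2) * Gamma ((real j + real n - 1) / 2)) /
      (sphere_area (n - k - 1) * sphere_area k * (Gamma ((real k + 1) / 2))\<^sup>2 *
         Gamma (real j / 2 + 1) * Gamma ((real j + real n - real k) / 2)))"

definition stiefel_harmonic ::
    "nat \<Rightarrow> nat \<Rightarrow> nat \<Rightarrow> (real ^ 'm::finite \<Rightarrow> complex) \<Rightarrow> (real ^ 'l::finite ^ 'm \<Rightarrow> complex)" where
  "stiefel_harmonic n k j Y = (\<lambda>v\<in>stiefel_manifold.
     of_real (varkappa n k j * sqrt (harmonics_dim n j)) *
     (\<integral>x. Y x * of_real (jacobi_R ((real k - 1) / 2) ((real n - real k) / 2 - 1) (j div 2)
                          (2 * (norm (x v* v))\<^sup>2 - 1)) \<partial>sphere_measure))"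

definition v0 ::
    "nat \<Rightarrow> nat \<Rightarrow> (nat \<Rightarrow> 'm::finite) \<Rightarrow> (nat \<Rightarrow> 'l::finite) \<Rightarrow> real ^ 'l ^ 'm" where
  "v0 n k r c = (\<chi> a b. if \<exists>i\<in>{1..n - k}. a = r (k + 1 + i) \<and> b = c i then 1 else 0)"

definition plane_rotation :: "nat \<Rightarrow> nat \<Rightarrow> (nat \<Rightarrow> 'm::finite) \<Rightarrow> real \<Rightarrow> real ^ 'm ^ 'm" where
  "plane_rotation n k r \<theta> = (\<chi> a b.
     if a = r (k + 1) \<and> b = r (k + 1) then cos \<theta>
     else if a = r (k + 1) \<and> b = r (n + 1) then sin \<theta>
     else if a = r (n + 1) \<and> b = r (k + 1) then - sin \<theta>
     else if a = r (n + 1) \<and> b = r (n + 1) then cos \<theta>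
     else if a = b then 1 else 0)"

definition stabilizer_K :: "nat \<Rightarrow> (nat \<Rightarrow> 'm::finite) \<Rightarrow> (real ^ 'm ^ 'm) set" where
  "stabilizer_K n r = {A. rotation_matrix A \<and> A *v unit_vec r (n + 1) = unit_vec r (n + 1)}"

text \<open>
  \<open>SO(n-k) \<times> SO(k+1)\<close> inside \<open>SO(n+1)\<close>: the rotation group of a coordinate subspace is the group of
  rotations fixing the complementary basis vectors.
\<close>

definition group_K' :: "nat \<Rightarrow> nat \<Rightarrow> (nat \<Rightarrow> 'm::finite) \<Rightarrow> (real ^ 'm ^ 'm) set" where
  "group_K' n k r = {A ** B | A B.
     rotation_matrix A \<and> (\<forall>i\<in>{1..k + 1}. A *v unit_vec r i = unit_vec r i) \<and>
     rotation_matrix B \<and> (\<forall>i\<in>{k + 2..n + 1}. B *v unit_vec r i = unit_vec r i)}"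

definition haar_prob_measure ::
    "(real ^ 'm ^ 'm::finite) set \<Rightarrow> (real ^ 'm ^ 'm) measure \<Rightarrow> bool" where
  "haar_prob_measure G \<mu> \<longleftrightarrow>
     prob_space \<mu> \<and> sets \<mu> = sets (restrict_space borel G) \<and>
     (\<forall>g\<in>G. distr \<mu> \<mu> (\<lambda>h. g ** h) = \<mu>)"

text \<open>
  \<open>\<mu>'\<close> and \<open>\<mu>\<close> are the Haar probability measures of \<open>K'\<close> and \<open>K\<close>, and \<open>rot x\<close> is the chosen rotation
  taking the last basis vector to \<open>x\<close>.
\<close>

definition dual_bispherical_mean ::
    "nat \<Rightarrow> nat \<Rightarrow> (nat \<Rightarrow> 'm::finite) \<Rightarrow> (nat \<Rightarrow> 'l::finite) \<Rightarrow>
     (real ^ 'm ^ 'm) measure \<Rightarrow> (real ^ 'm ^ 'm) measure \<Rightarrow> (real ^ 'm \<Rightarrow> real ^ 'm ^ 'm) \<Rightarrow>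
     real \<Rightarrow> (real ^ 'l ^ 'm \<Rightarrow> complex) \<Rightarrow> real ^ 'm \<Rightarrow> complex" where
  "dual_bispherical_mean n k r c \<mu>' \<mu> rot \<tau> \<phi> x =
     (\<integral>(\<gamma>, \<delta>). \<phi> (rot x ** matrix_inv \<delta> ** matrix_inv (plane_rotation n k r (arccos \<tau>)) **
                  matrix_inv \<gamma> ** v0 n k r c) \<partial>(\<mu>' \<Otimes>\<^sub>M \<mu>))"

end

theory Submission
  imports Defs
begin

text \<open>
  Write \<open>e\<close> for the last basis vector, \<open>w\<^sub>e\<close> for the corresponding coordinate of \<open>w\<close>, and let \<open>q\<close> be the
  function \<open>w \<mapsto> R(2 |w\<^sup>Tv\<^sub>0|\<^sup>2 - 1)\<close> with \<open>R\<close> the normalized Jacobi polynomial of degree \<open>j/2\<close>.  On the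
  sphere \<open>q\<close> is the restriction of a harmonic form of degree \<open>j\<close>
  (\<open>homogeneous_harmonic_jacobi_form\<close>).  Since \<open>K'\<close> preserves \<open>|w\<^sup>Tv\<^sub>0|\<close>, the integration over \<open>K'\<close> is
  without effect, and the mean of the Stiefel harmonic of \<open>Y\<close> is, up to the factor
  \<open>\<varkappa>\<^sub>j \<surd>d\<^sub>n(j)\<close>, the average over \<open>\<delta> \<in> K\<close> of the correlation
  \<open>\<integral> Y(w) q(g \<delta> r\<^sub>x\<inverse> w) dw\<close>.

  This average is evaluated for two arbitrary harmonic forms of the same degree
  (\<open>stabilizer_mean_of_correlation\<close>).  The substitution \<open>w \<mapsto> r\<^sub>x \<delta>\<inverse> w\<close> moves \<open>\<delta>\<close> from \<open>q\<close> to \<open>Y\<close>.  The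
  mean of \<open>Y(r\<^sub>x \<delta>\<inverse> w)\<close> over \<open>K\<close> is a harmonic form that is invariant under \<open>K\<close>, and such a form is
  determined by its value at \<open>e\<close>: it equals \<open>Y(x) Z\<close>, where \<open>Z\<close> is the zonal harmonic with \<open>Z(e) = 1\<close>
  (\<open>stabilizer_mean_eq_zonal\<close>).  As \<open>Z\<close> is itself invariant under \<open>K\<close>, the other factor \<open>q(g w)\<close> can be
  averaged in the same way and becomes \<open>q(g e) Z\<close>.  What remains is \<open>Y(x) q(g e) \<integral> Z\<^sup>2\<close>, and
  \<open>\<integral> Z\<^sup>2 = 1 / d\<^sub>n(j)\<close> (\<open>zonal_square_integral\<close>).  Because \<open>g e\<close> has last coordinate \<open>\<tau>\<close> and its other
  component lies in the span of the first \<open>k+1\<close> basis vectors, \<open>q(g e) = R(2 \<tau>\<^sup>2 - 1)\<close>.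

  Two facts carry the zonal part.  The forms \<open>Z\<^sub>j\<close> satisfy \<open>\<partial>\<^sub>e Z\<^sub>j = j Z\<^sub>j\<^sub>-\<^sub>1\<close> next to their three-term
  recurrence.  This gives harmonicity, and it gives uniqueness by induction on the degree, because
  \<open>\<partial>\<^sub>e\<close> maps invariant harmonic forms to invariant harmonic forms
  (\<open>axially_symmetric_harmonic_unique\<close>).  Rotation invariance of the sphere measure yields
  \<open>\<integral> \<partial>\<^sub>e F = (n + deg F) \<integral> w\<^sub>e F\<close> for every form \<open>F\<close> (\<open>sphere_integral_by_parts\<close>); applied to
  \<open>Z\<^sub>i Z\<^sub>j\<close>, it turns the recurrence into a recursion for \<open>\<integral> Z\<^sub>j\<^sup>2\<close> that is inverse to the one for
  the dimensions \<open>d\<^sub>n(j)\<close>.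

  All functions involved are polynomials in the space variable.  Averages and integrals are therefore
  finite combinations of the integrals of their coefficients, which makes them interchangeable with each
  other and with derivatives by linearity (\<open>separable\<close>).
\<close>

section \<open>Partial derivatives of polynomials\<close>

abbreviation poly_fun :: "(real ^ 'm::finite \<Rightarrow> real) \<Rightarrow> bool" where
  "poly_fun \<equiv> real_polynomial_function"

definition pd :: "'m::finite \<Rightarrow> (real ^ 'm \<Rightarrow> real) \<Rightarrow> real ^ 'm \<Rightarrow> real" where
  "pd a F x = deriv (\<lambda>t. F (x + t *\<^sub>R axis a 1)) 0"

named_theorems poly_intros

lemma poly_fun_nth [poly_intros]: "poly_fun (\<lambda>x. x $ a)"
  by (intro real_polynomial_function.intros(1) bounded_linear_vec_nth)

lemma poly_fun_inner_self [poly_intros]: "poly_fun (\<lambda>x. x \<bullet> x)"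
  unfolding inner_vec_def by (auto intro!: poly_fun_nth)

lemmas [poly_intros] = real_polynomial_function.intros(2-4)
  real_polynomial_function_diff real_polynomial_function_minus
  real_polynomial_function_power real_polynomial_function_divide
  real_polynomial_function_sum[OF finite]

lemma has_partial_derivative_ex:
  assumes "poly_fun F"
  shows "\<exists>F'. poly_fun F' \<and> (\<forall>x. ((\<lambda>t. F (x + t *\<^sub>R axis a 1)) has_real_derivative F' x) (at 0))"
  using assms
proof induction
  case (linear f)
  then have "f (x + t *\<^sub>R axis a 1) = f x + t * f (axis a 1)" for x t
    by (simp add: linear_add linear_scale bounded_linear.linear)
  then have "((\<lambda>t. f (x + t *\<^sub>R axis a 1)) has_real_derivative f (axis a 1)) (at 0)" for x
    by (auto intro!: derivative_eq_intros)
  then show ?case by (intro exI[of _ "\<lambda>x. f (axis a 1)"]) auto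
next
  case (const c)
  then show ?case by (intro exI[of _ "\<lambda>x. 0"]) auto
next
  case (add f g)
  then obtain f' g' where "poly_fun f'" "poly_fun g'"
    "\<And>x. ((\<lambda>t. f (x + t *\<^sub>R axis a 1)) has_real_derivative f' x) (at 0)"
    "\<And>x. ((\<lambda>t. g (x + t *\<^sub>R axis a 1)) has_real_derivative g' x) (at 0)" by blast
  then show ?case
    by (intro exI[of _ "\<lambda>x. f' x + g' x"]) (auto intro!: derivative_eq_intros)
next
  case (mult f g)
  then obtain f' g' where "poly_fun f'" "poly_fun g'"
    "\<And>x. ((\<lambda>t. f (x + t *\<^sub>R axis a 1)) has_real_derivative f' x) (at 0)"
    "\<And>x. ((\<lambda>t. g (x + t *\<^sub>R axis a 1)) has_real_derivative g' x) (at 0)" by blast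
  with mult show ?case
    by (intro exI[of _ "\<lambda>x. f' x * g x + g' x * f x"]) (auto intro!: derivative_eq_intros)
qed

lemma pd_eqI:
  assumes "\<And>x. ((\<lambda>t. F (x + t *\<^sub>R axis a 1)) has_real_derivative F' x) (at 0)"
  shows "pd a F = F'"
  unfolding pd_def using assms by (auto intro!: ext DERIV_imp_deriv)

lemma poly_fun_pd [poly_intros]: "poly_fun F \<Longrightarrow> poly_fun (pd a F)"
  using has_partial_derivative_ex[of F a] pd_eqI[of F a] by metis

lemma has_pd0: "poly_fun F \<Longrightarrow>
    ((\<lambda>t. F (x + t *\<^sub>R axis a 1)) has_real_derivative pd a F x) (at 0)"
  using has_partial_derivative_ex[of F a] pd_eqI[of F a] by metis

lemma has_pd:
  assumes "poly_fun F"
  shows "((\<lambda>t. F (x + t *\<^sub>R axis a 1)) has_real_derivative pd a F (x + s *\<^sub>R axis a 1)) (at s)"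
proof -
  have "((\<lambda>t. F ((x + s *\<^sub>R axis a 1) + t *\<^sub>R axis a 1)) has_real_derivative
          pd a F (x + s *\<^sub>R axis a 1)) (at 0)"
    by (rule has_pd0[OF assms])
  then show ?thesis
    using DERIV_shift[of "\<lambda>t. F (x + t *\<^sub>R axis a 1)" "pd a F (x + s *\<^sub>R axis a 1)" 0 s]
    by (simp add: algebra_simps)
qed

lemma pd_const [simp]: "pd a (\<lambda>x. c) = (\<lambda>x. 0)"
  by (rule pd_eqI) auto

lemma pd_nth [simp]: "pd a (\<lambda>x. x $ b) = (\<lambda>x. if a = b then 1 else 0)"
  by (rule pd_eqI) (auto simp: axis_def intro!: derivative_eq_intros)

lemma pd_add: "poly_fun F \<Longrightarrow> poly_fun G \<Longrightarrow> pd a (\<lambda>x. F x + G x) = (\<lambda>x. pd a F x + pd a G x)"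
  by (rule pd_eqI) (auto intro!: derivative_eq_intros has_pd0)

lemma pd_diff: "poly_fun F \<Longrightarrow> poly_fun G \<Longrightarrow> pd a (\<lambda>x. F x - G x) = (\<lambda>x. pd a F x - pd a G x)"
  by (rule pd_eqI) (auto intro!: derivative_eq_intros has_pd0)

lemma pd_mult: "poly_fun F \<Longrightarrow> poly_fun G \<Longrightarrow>
    pd a (\<lambda>x. F x * G x) = (\<lambda>x. pd a F x * G x + F x * pd a G x)"
  by (rule pd_eqI) (auto intro!: derivative_eq_intros has_pd0)

lemma pd_cmult: "poly_fun F \<Longrightarrow> pd a (\<lambda>x. c * F x) = (\<lambda>x. c * pd a F x)"
  by (simp add: pd_mult poly_intros)

lemma pd_power: "poly_fun F \<Longrightarrow>
    pd a (\<lambda>x. F x ^ m) = (\<lambda>x. real m * F x ^ (m - 1) * pd a F x)"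
  by (rule pd_eqI) (auto intro!: derivative_eq_intros has_pd0)

lemma pd_sum: "(\<And>i. i \<in> I \<Longrightarrow> poly_fun (F i)) \<Longrightarrow>
    pd a (\<lambda>x. \<Sum>i\<in>I. F i x) = (\<lambda>x. \<Sum>i\<in>I. pd a (F i) x)"
  by (rule pd_eqI) (auto intro!: derivative_eq_intros has_pd0)

lemma pd_inner_self: "pd a (\<lambda>x. x \<bullet> x) = (\<lambda>x. 2 * x $ a)"
proof (rule pd_eqI)
  fix x :: "real ^ 'a"
  show "((\<lambda>t. (x + t *\<^sub>R axis a 1) \<bullet> (x + t *\<^sub>R axis a 1)) has_real_derivative 2 * x $ a) (at 0)"
    by (auto simp: inner_axis inner_axis' inner_add_left inner_add_right intro!: derivative_eq_intros)
qed

lemma linear_expansion: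
  fixes f :: "real ^ 'm::finite \<Rightarrow> real"
  assumes "bounded_linear f"
  shows "f x = (\<Sum>a\<in>UNIV. x $ a * f (axis a 1))"
proof -
  have "f x = f (\<Sum>a\<in>UNIV. x $ a *\<^sub>R axis a 1)"
    using basis_expansion[of x] by (simp add: scalar_mult_eq_scaleR)
  then show ?thesis
    using assms by (simp add: linear_sum linear_scale bounded_linear.linear)
qed

lemma poly_fun_chain_rule:
  assumes "poly_fun F" and c: "\<And>a. ((\<lambda>t. c t $ a) has_real_derivative c' a) (at t)"
  shows "((\<lambda>t. F (c t)) has_real_derivative (\<Sum>a\<in>UNIV. c' a * pd a F (c t))) (at t)"
  using assms(1)
proof induction
  case (linear f)
  have "pd a f = (\<lambda>x. f (axis a 1))" for a
    using linear by (intro pd_eqI)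
      (auto simp: linear_add linear_scale bounded_linear.linear intro!: derivative_eq_intros)
  then show ?case
    by (subst linear_expansion[OF linear]) (auto intro!: derivative_eq_intros c)
next
  case (const d)
  then show ?case by auto
next
  case (add f g)
  then show ?case
    by (auto intro!: derivative_eq_intros simp: pd_add sum.distrib algebra_simps)
next
  case (mult f g)
  then show ?case
    by (auto intro!: derivative_eq_intros
        simp: pd_mult sum.distrib sum_distrib_left sum_distrib_right algebra_simps)
qed

lemma pd_commute:
  assumes "poly_fun F"
  shows "pd a (pd b F) = pd b (pd a F)"
  using assms
proof induction
  case (linear f)
  have "pd a f = (\<lambda>x. f (axis a 1))" for a
    using linear by (intro pd_eqI)
      (auto simp: linear_add linear_scale bounded_linear.linear intro!: derivative_eq_intros)
  then show ?case by simp
next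
  case (const c)
  show ?case by simp
next
  case (add f g)
  then show ?case by (simp add: pd_add poly_intros)
next
  case (mult f g)
  then show ?case by (simp add: pd_add pd_mult poly_intros algebra_simps)
qed

lemma euler_homogeneous:
  assumes "poly_fun F" and hom: "\<And>s x. F (s *\<^sub>R x) = s ^ j * F x"
  shows "(\<Sum>a\<in>UNIV. x $ a * pd a F x) = real j * F x"
proof -
  have "((\<lambda>s. F (s *\<^sub>R x)) has_real_derivative (\<Sum>a\<in>UNIV. x $ a * pd a F (1 *\<^sub>R x))) (at 1)"
    by (rule poly_fun_chain_rule[OF assms(1)]) (auto intro!: derivative_eq_intros)
  moreover have "((\<lambda>s. F (s *\<^sub>R x)) has_real_derivative real j * F x) (at 1)"
    unfolding hom by (auto intro!: derivative_eq_intros)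
  ultimately show ?thesis using DERIV_unique by force
qed

text \<open>
  For \<open>s \<noteq> 0\<close> this is the chain rule for \<open>x \<mapsto> s x\<close>; the value \<open>s = 0\<close> then follows by
  continuity of the polynomial \<open>pd a F\<close>.
\<close>

lemma pd_homogeneous:
  assumes "poly_fun F" and hom: "\<And>s x. F (s *\<^sub>R x) = s ^ j * F x" and "j \<ge> 1"
  shows "pd a F (s *\<^sub>R x) = s ^ (j - 1) * pd a F x"
proof -
  have scaled: "pd a F (u *\<^sub>R x) = u ^ (j - 1) * pd a F x" if "u \<noteq> 0" for u
  proof -
    have "((\<lambda>t. F (u *\<^sub>R (x + t *\<^sub>R axis a 1))) has_real_derivative
            (\<Sum>b\<in>UNIV. (u * axis a 1 $ b) * pd b F (u *\<^sub>R (x + 0 *\<^sub>R axis a 1)))) (at 0)"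
      by (rule poly_fun_chain_rule[OF assms(1)]) (auto intro!: derivative_eq_intros)
    moreover have "(\<Sum>b\<in>UNIV. (u * axis a 1 $ b) * pd b F (u *\<^sub>R (x + 0 *\<^sub>R axis a 1)))
        = u * pd a F (u *\<^sub>R x)"
      by (simp add: axis_def if_distrib if_distribR sum.delta cong: if_cong)
    moreover have "((\<lambda>t. F (u *\<^sub>R (x + t *\<^sub>R axis a 1))) has_real_derivative u ^ j * pd a F x) (at 0)"
      unfolding hom by (intro DERIV_cmult has_pd0 assms)
    ultimately have "u * pd a F (u *\<^sub>R x) = u ^ j * pd a F x"
      using DERIV_unique by metis
    also have "u ^ j = u * u ^ (j - 1)"
      using \<open>j \<ge> 1\<close> by (cases j) auto
    finally show ?thesis using that by simp
  qed
  have "isCont (pd a F) (0 *\<^sub>R x)"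
    by (rule continuous_real_polymonial_function[OF poly_fun_pd[OF assms(1)]])
  then have "((\<lambda>u. pd a F (u *\<^sub>R x)) \<longlongrightarrow> pd a F (0 *\<^sub>R x)) (at 0)"
    by (rule isCont_tendsto_compose) (intro tendsto_scaleR tendsto_ident_at tendsto_const)
  moreover have "((\<lambda>u. pd a F (u *\<^sub>R x)) \<longlongrightarrow> 0 ^ (j - 1) * pd a F x) (at 0)"
  proof (rule Lim_transform_eventually)
    show "((\<lambda>u. u ^ (j - 1) * pd a F x) \<longlongrightarrow> 0 ^ (j - 1) * pd a F x) (at 0)"
      by (intro tendsto_intros)
    show "\<forall>\<^sub>F u in at 0. u ^ (j - 1) * pd a F x = pd a F (u *\<^sub>R x)"
      unfolding eventually_at_filter by (simp add: scaled)
  qed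
  ultimately have "pd a F (0 *\<^sub>R x) = 0 ^ (j - 1) * pd a F x"
    by (rule tendsto_unique[rotated]) simp
  then show ?thesis using scaled by (cases "s = 0") auto
qed

text \<open>
  The real Laplacian in terms of \<open>pd\<close>, so that the rules above apply; \<open>laplacian_component\<close>
  relates it to \<open>laplacian\<close> on complex polynomials.
\<close>

definition lap :: "(real ^ 'm::finite \<Rightarrow> real) \<Rightarrow> real ^ 'm \<Rightarrow> real" where
  "lap F x = (\<Sum>a\<in>UNIV. pd a (pd a F) x)"

definition homogeneous_harmonic :: "nat \<Rightarrow> (real ^ 'm::finite \<Rightarrow> real) \<Rightarrow> bool" where
  "homogeneous_harmonic j F \<longleftrightarrow>
     poly_fun F \<and> (\<forall>s x. F (s *\<^sub>R x) = s ^ j * F x) \<and> (\<forall>x. lap F x = 0)"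

section \<open>Zonal harmonics and their uniqueness\<close>

text \<open>
  The zonal harmonics with pole \<open>axis e 1\<close>, normalized to the value 1 there.  On the sphere
  they are the normalized Gegenbauer polynomials of \<open>w $ e\<close> with parameter \<open>(n - 1) / 2\<close>;
  the factor \<open>w \<bullet> w\<close> makes the classical three-term recurrence homogeneous.
\<close>

fun zonal :: "nat \<Rightarrow> 'm \<Rightarrow> nat \<Rightarrow> real ^ 'm::finite \<Rightarrow> real" where
  "zonal n e 0 = (\<lambda>w. 1)"
| "zonal n e (Suc 0) = (\<lambda>w. w $ e)"
| "zonal n e (Suc (Suc j)) = (\<lambda>w.
     (real (2 * j + n + 1) * (w $ e * zonal n e (Suc j) w) - real (j + 1) * (w \<bullet> w * zonal n e j w)) / real (j + n))"

lemma poly_fun_zonal [poly_intros]: "poly_fun (zonal n e j)"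
  by (induction n e j rule: zonal.induct) (simp_all add: poly_intros)

lemma zonal_homogeneous: "zonal n e j (s *\<^sub>R w) = s ^ j * zonal n e j w"
proof (induction n e j rule: zonal.induct)
  case (3 n e j)
  then show ?case by (simp add: power2_eq_square algebra_simps diff_divide_distrib add_divide_distrib)
qed simp_all

lemma zonal_recurrence:
  "0 < n \<Longrightarrow> real (j + n) * zonal n e (Suc (Suc j)) w =
     real (2 * j + n + 1) * (w $ e * zonal n e (Suc j) w) - real (j + 1) * (w \<bullet> w * zonal n e j w)"
  by simp

lemma pd_zonal_Suc_Suc:
  assumes "0 < n"
  shows "real (j + n) * pd a (zonal n e (Suc (Suc j))) w =
     real (2 * j + n + 1) * ((if a = e then zonal n e (Suc j) w else 0) + w $ e * pd a (zonal n e (Suc j)) w)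
     - real (j + 1) * (2 * w $ a * zonal n e j w + w \<bullet> w * pd a (zonal n e j) w)"
proof -
  have "real (j + n) * pd a (zonal n e (Suc (Suc j))) w
      = pd a (\<lambda>w. real (j + n) * zonal n e (Suc (Suc j)) w) w"
    by (simp only: pd_cmult poly_intros)
  also have "\<dots> = pd a (\<lambda>w. real (2 * j + n + 1) * (w $ e * zonal n e (Suc j) w)
      - real (j + 1) * (w \<bullet> w * zonal n e j w)) w"
    by (simp only: zonal_recurrence[OF assms])
  also have "\<dots> = real (2 * j + n + 1) * ((if a = e then zonal n e (Suc j) w else 0) + w $ e * pd a (zonal n e (Suc j)) w)
     - real (j + 1) * (2 * w $ a * zonal n e j w + w \<bullet> w * pd a (zonal n e j) w)"
    by (simp add: pd_diff pd_mult pd_cmult pd_inner_self poly_intros del: of_nat_add of_nat_mult of_nat_Suc zonal.simps)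
  finally show ?thesis .
qed

text \<open>
  The Appell property.  Differentiating the recurrence and inserting the induction hypothesis
  leaves a combination of \<open>w $ e * Z\<^sub>j\<close> and \<open>w \<bullet> w * Z\<^sub>j\<^sub>-\<^sub>1\<close> that is again the right-hand
  side of a recurrence.
\<close>

lemma pd_zonal_pole:
  assumes "0 < n"
  shows "pd e (zonal n e (Suc j)) w = real (Suc j) * zonal n e j w"
proof (induction j rule: less_induct)
  case (less j)
  consider "j = 0" | "j = 1" | i where "j = Suc (Suc i)"
    by (metis One_nat_def not0_implies_Suc)
  then show ?case
  proof cases
    case 1
    then show ?thesis by simp
  next
    case 2
    have "real n * pd e (zonal n e (Suc (Suc 0))) w = 2 * real n * w $ e"
      using pd_zonal_Suc_Suc[OF assms, of 0 e e w] by (simp add: algebra_simps del: zonal.simps(3))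
    then show ?thesis using assms 2 by (simp del: zonal.simps(3))
  next
    case 3
    define z where "z i = zonal n e i w" for i
    have ih1: "pd e (zonal n e (Suc (Suc i))) w = real (Suc (Suc i)) * z (Suc i)"
      and ih0: "pd e (zonal n e (Suc i)) w = real (Suc i) * z i"
      using less[of "Suc i"] less[of i] 3 by (simp_all add: z_def)
    have rec: "real (i + n) * z (Suc (Suc i)) =
      real (2 * i + n + 1) * (w $ e * z (Suc i)) - real (i + 1) * (w \<bullet> w * z i)"
      unfolding z_def by (rule zonal_recurrence[OF assms])
    have "real (Suc i + n) * pd e (zonal n e (Suc (Suc (Suc i)))) w
       = real (2 * Suc i + n + 1) * (z (Suc (Suc i)) + w $ e * (real (Suc (Suc i)) * z (Suc i)))
        - real (Suc i + 1) * (2 * w $ e * z (Suc i) + w \<bullet> w * (real (Suc i) * z i))"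
      using pd_zonal_Suc_Suc[OF assms, of "Suc i" e e w] ih0 ih1 by (simp add: z_def del: zonal.simps)
    also have "\<dots> = real (2 * Suc i + n + 1) * z (Suc (Suc i)) + real (i + 2) * (real (i + n) * z (Suc (Suc i)))"
      unfolding rec by (simp add: algebra_simps)
    also have "\<dots> = real (Suc i + n) * (real (Suc j) * z (Suc (Suc i)))"
      by (simp add: 3 algebra_simps)
    finally have "pd e (zonal n e (Suc (Suc (Suc i)))) w = real (Suc j) * z (Suc (Suc i))"
      using assms by (simp del: of_nat_add of_nat_Suc zonal.simps)
    then show ?thesis by (simp add: 3 z_def del: zonal.simps)
  qed
qed

lemma lap_cmult: "poly_fun F \<Longrightarrow> lap (\<lambda>x. c * F x) = (\<lambda>x. c * lap F x)"
  by (rule ext) (simp add: lap_def pd_cmult poly_intros sum_distrib_left)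

lemma lap_diff: "poly_fun F \<Longrightarrow> poly_fun G \<Longrightarrow> lap (\<lambda>x. F x - G x) = (\<lambda>x. lap F x - lap G x)"
  by (rule ext) (simp add: lap_def pd_diff poly_intros sum_subtractf)

lemma lap_pd_commute:
  assumes "poly_fun F"
  shows "lap (pd e F) = pd e (lap F)"
proof -
  have comm: "pd e (pd a (pd a F)) = pd a (pd a (pd e F))" for a
  proof -
    have "pd e (pd a (pd a F)) = pd a (pd e (pd a F))"
      by (rule pd_commute[OF poly_fun_pd[OF assms]])
    also have "pd e (pd a F) = pd a (pd e F)"
      by (rule pd_commute[OF assms])
    finally show ?thesis .
  qed
  have "pd e (lap F) = pd e (\<lambda>x. \<Sum>a\<in>UNIV. pd a (pd a F) x)"
    by (rule arg_cong[where f = "pd e"]) (rule ext, rule lap_def)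
  also have "\<dots> = (\<lambda>x. \<Sum>a\<in>UNIV. pd e (pd a (pd a F)) x)"
    by (rule pd_sum) (intro poly_fun_pd assms)
  also have "\<dots> = (\<lambda>x. \<Sum>a\<in>UNIV. pd a (pd a (pd e F)) x)"
    by (intro ext sum.cong refl) (rule fun_cong[OF comm])
  also have "\<dots> = lap (pd e F)"
    by (rule ext) (rule lap_def[symmetric])
  finally show ?thesis by (rule sym)
qed

lemma lap_mult:
  "poly_fun F \<Longrightarrow> poly_fun G \<Longrightarrow> lap (\<lambda>x. F x * G x) x =
     lap F x * G x + 2 * (\<Sum>a\<in>UNIV. pd a F x * pd a G x) + F x * lap G x"
  by (simp add: lap_def pd_mult pd_add poly_intros sum.distrib sum_distrib_left sum_distrib_right
      algebra_simps)

lemma lap_nth_mult: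
  assumes "poly_fun F"
  shows "lap (\<lambda>x. x $ e * F x) x = 2 * pd e F x + x $ e * lap F x"
  using lap_mult[OF poly_fun_nth[of e] assms] by (simp add: lap_def if_distrib if_distribR cong: if_cong)

lemma lap_inner_self_mult:
  assumes "poly_fun F" "\<And>s x. F (s *\<^sub>R x) = s ^ j * F x"
  shows "lap (\<lambda>x. x \<bullet> x * F x) (x :: real ^ 'm::finite) =
    (2 * real CARD('m) + 4 * real j) * F x + x \<bullet> x * lap F x"
proof -
  have "(\<Sum>a\<in>UNIV. pd a (\<lambda>x. x \<bullet> x) x * pd a F x) = 2 * (\<Sum>a\<in>UNIV. x $ a * pd a F x)"
    by (simp add: pd_inner_self sum_distrib_left mult.assoc)
  moreover have "lap (\<lambda>x. x \<bullet> x) x = 2 * real CARD('m)"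
    by (simp add: lap_def pd_inner_self pd_cmult poly_intros)
  ultimately show ?thesis
    using lap_mult[OF poly_fun_inner_self assms(1), of x] euler_homogeneous[OF assms, of x]
    by (simp add: algebra_simps)
qed

text \<open>
  In \<open>lap\<close> of the recurrence, the first product contributes \<open>2 pd e Z\<^sub>j\<^sub>+\<^sub>1 = 2 (j + 1) Z\<^sub>j\<close>
  and the second \<open>(2 (n + 1) + 4 j) Z\<^sub>j\<close>; with the coefficients of the recurrence the two
  cancel.
\<close>

lemma lap_zonal:
  assumes "CARD('m) = n + 1" "0 < n"
  shows "lap (zonal n e j) (w :: real ^ 'm::finite) = 0"
proof (induction j rule: less_induct)
  case (less j)
  consider "j = 0" | "j = 1" | i where "j = Suc (Suc i)"
    by (metis One_nat_def not0_implies_Suc)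
  then show ?case
  proof cases
    case 3
    define z where "z i = zonal n e i w" for i
    have "real (i + n) * lap (zonal n e j) w = lap (\<lambda>w. real (i + n) * zonal n e (Suc (Suc i)) w) w"
      unfolding 3 by (simp only: lap_cmult poly_intros)
    also have "\<dots> = lap (\<lambda>w. real (2 * i + n + 1) * (w $ e * zonal n e (Suc i) w) - real (i + 1) * (w \<bullet> w * zonal n e i w)) w"
      by (simp only: zonal_recurrence[OF assms(2)])
    also have "\<dots> = real (2 * i + n + 1) * (2 * (real (Suc i) * zonal n e i w))
        - real (i + 1) * ((2 * real CARD('m) + 4 * real i) * zonal n e i w)"
      by (simp only: lap_diff lap_cmult poly_intros lap_nth_mult pd_zonal_pole[OF assms(2)]
          lap_inner_self_mult[OF poly_fun_zonal zonal_homogeneous] less[of i] less[of "Suc i"] 3)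
        (use less[of i] less[of "Suc i"] 3 in simp)
    also have "\<dots> = 0"
      by (simp add: assms algebra_simps)
    finally show ?thesis using assms by simp
  qed (simp_all add: lap_def)
qed

text \<open>
  Invariance under the rotations that fix \<open>axis e 1\<close>, stated through their infinitesimal
  generators \<open>x\<^sub>a \<partial>\<^sub>b - x\<^sub>b \<partial>\<^sub>a\<close>.  In this form it passes to \<open>pd e F\<close>, since \<open>pd e\<close> commutes
  with these generators.
\<close>

definition axially_symmetric :: "'m::finite \<Rightarrow> (real ^ 'm \<Rightarrow> real) \<Rightarrow> bool" where
  "axially_symmetric e F \<longleftrightarrow> (\<forall>a b x. a \<noteq> e \<longrightarrow> b \<noteq> e \<longrightarrow> x $ a * pd b F x = x $ b * pd a F x)"

lemma axially_symmetric_zonal: "0 < n \<Longrightarrow> axially_symmetric e (zonal n e j)"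
proof (induction j rule: less_induct)
  case (less j)
  consider "j = 0" | "j = 1" | i where "j = Suc (Suc i)"
    by (metis One_nat_def not0_implies_Suc)
  then show ?case
  proof cases
    case 3
    show ?thesis unfolding axially_symmetric_def
    proof (intro allI impI)
      fix a b :: 'a and x assume ab: "a \<noteq> e" "b \<noteq> e"
      have ih: "x $ a * pd b (zonal n e (Suc i)) x = x $ b * pd a (zonal n e (Suc i)) x"
        "x $ a * pd b (zonal n e i) x = x $ b * pd a (zonal n e i) x"
        using less.IH[of i] less.IH[of "Suc i"] less.prems 3 ab unfolding axially_symmetric_def by auto
      have step: "real (i + n) * (x $ u * pd v (zonal n e j) x) =
          real (2 * i + n + 1) * (x $ e * (x $ u * pd v (zonal n e (Suc i)) x))
          - real (i + 1) * (2 * x $ u * x $ v * zonal n e i x + x \<bullet> x * (x $ u * pd v (zonal n e i) x))"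
        if "v \<noteq> e" for u v
        using arg_cong[OF pd_zonal_Suc_Suc[OF less.prems, of i v e x], of "\<lambda>y. x $ u * y"] that
        by (simp add: 3 algebra_simps del: zonal.simps)
      have "real (i + n) * (x $ a * pd b (zonal n e j) x) = real (i + n) * (x $ b * pd a (zonal n e j) x)"
        unfolding step[OF ab(1)] step[OF ab(2)] ih by (simp add: algebra_simps)
      then show "x $ a * pd b (zonal n e j) x = x $ b * pd a (zonal n e j) x"
        using less.prems by (simp del: of_nat_add)
    qed
  qed (auto simp: axially_symmetric_def)
qed

text \<open>
  If \<open>F\<close> is independent of \<open>x $ e\<close>, then symmetry and Euler's identity give \<open>\<rho> \<partial>\<^sub>b F = j x\<^sub>b
  F\<close>, where \<open>\<rho>\<close> is the sum of the squares of the other coordinates.  Applying \<open>\<partial>\<^sub>b\<close> once more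
  and summing over \<open>b \<noteq> e\<close>, harmonicity leaves \<open>j (j + n - 2) F = 0\<close>.
\<close>

lemma harmonic_cylinder_eq_0:
  fixes F :: "real ^ 'm::finite \<Rightarrow> real"
  assumes F: "homogeneous_harmonic j F" and sym: "axially_symmetric e F"
    and flat: "\<And>x. pd e F x = 0" and card: "CARD('m) = n + 1" "2 \<le> n" and "1 \<le> j"
  shows "F x = 0"
proof -
  have [poly_intros]: "poly_fun F" and hom: "\<And>s x. F (s *\<^sub>R x) = s ^ j * F x" and harm: "\<And>x. lap F x = 0"
    using F by (auto simp: homogeneous_harmonic_def)
  have euler: "(\<Sum>a\<in>UNIV - {e}. x $ a * pd a F x) = real j * F x" for x
    using euler_homogeneous[OF \<open>poly_fun F\<close> hom, of x] by (simp add: sum.remove[of UNIV e] flat)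
  define \<rho> where "\<rho> x = x \<bullet> x - x $ e * x $ e" for x :: "real ^ 'm"
  have \<rho>: "\<rho> x = (\<Sum>a\<in>UNIV - {e}. x $ a * x $ a)" for x
    by (simp add: \<rho>_def inner_vec_def sum.remove[of UNIV e])
  have [poly_intros]: "poly_fun \<rho>" unfolding \<rho>_def by (intro poly_intros)
  have pd\<rho>: "pd b \<rho> = (\<lambda>x. 2 * x $ b)" if "b \<noteq> e" for b
    unfolding \<rho>_def using that by (simp add: pd_diff pd_mult pd_inner_self poly_intros)
  have radial: "\<rho> x * pd b F x = real j * (x $ b * F x)" if "b \<noteq> e" for b x
  proof -
    have "\<rho> x * pd b F x = (\<Sum>a\<in>UNIV - {e}. x $ a * (x $ a * pd b F x))"
      by (simp add: \<rho> sum_distrib_right mult.assoc)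
    also have "\<dots> = (\<Sum>a\<in>UNIV - {e}. x $ a * (x $ b * pd a F x))"
      using sym that by (intro sum.cong refl) (auto simp: axially_symmetric_def)
    also have "\<dots> = x $ b * (\<Sum>a\<in>UNIV - {e}. x $ a * pd a F x)"
      by (simp add: sum_distrib_left mult_ac)
    finally show ?thesis by (simp add: euler)
  qed
  have second: "2 * (x $ b * pd b F x) + \<rho> x * pd b (pd b F) x = real j * F x + real j * (x $ b * pd b F x)"
    if "b \<noteq> e" for b x
  proof -
    have "pd b (\<lambda>x. \<rho> x * pd b F x) x = pd b (\<lambda>x. real j * (x $ b * F x)) x"
      by (simp only: radial[OF that])
    then show ?thesis
      using that by (simp add: pd_mult pd_cmult poly_intros pd\<rho> algebra_simps)
  qed
  have "(\<Sum>b\<in>UNIV - {e}. 2 * (x $ b * pd b F x) + \<rho> x * pd b (pd b F) x)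
      = (\<Sum>b\<in>UNIV - {e}. real j * F x + real j * (x $ b * pd b F x))"
    using second by (intro sum.cong) auto
  moreover have "(\<Sum>b\<in>UNIV - {e}. pd b (pd b F) x) = 0"
  proof -
    have "pd e F = (\<lambda>x. 0)" using flat by auto
    then have "pd e (pd e F) x = 0" by simp
    then show ?thesis using harm[of x] unfolding lap_def by (subst (asm) sum.remove[of UNIV e]) auto
  qed
  ultimately have "2 * (real j * F x) = real n * (real j * F x) + real j * (real j * F x)"
    by (simp add: sum.distrib euler card flip: sum_distrib_left)
  then have "(real j * (real j + real n - 2)) * F x = 0" by (simp add: algebra_simps)
  then show ?thesis using \<open>1 \<le> j\<close> card by auto
qed

text \<open>
  Induction on the degree: \<open>pd e F\<close> has degree one less, so it is the multiple of \<open>Z\<^sub>j\<close>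
  prescribed by its value at the pole, which Euler's identity computes from that of \<open>F\<close>.  By
  the Appell property \<open>F - F(e) Z\<^sub>j\<^sub>+\<^sub>1\<close> then has vanishing derivative along \<open>e\<close>, and the
  previous lemma applies.
\<close>

theorem axially_symmetric_harmonic_unique:
  fixes F :: "real ^ 'm::finite \<Rightarrow> real"
  assumes card: "CARD('m) = n + 1" "2 \<le> n"
    and "homogeneous_harmonic j F" and "axially_symmetric e F"
  shows "F x = F (axis e 1) * zonal n e j x"
  using assms(3,4)
proof (induction j arbitrary: F x)
  case 0
  then have "F (0 *\<^sub>R x) = F x" "F (0 *\<^sub>R axis e 1) = F (axis e 1)"
    by (simp_all only: homogeneous_harmonic_def power_0 mult_1)
  then show ?case by simp
next
  case (Suc j)
  then have poly [poly_intros]: "poly_fun F" and hom: "\<And>s x. F (s *\<^sub>R x) = s ^ Suc j * F x"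
    and harm: "lap F = (\<lambda>x. 0)"
    by (auto simp: homogeneous_harmonic_def)
  have lap_pd: "lap (pd e F) = pd e (lap F)"
    by (rule lap_pd_commute[OF poly])
  have "homogeneous_harmonic j (pd e F)"
    using pd_homogeneous[OF poly hom] lap_pd harm by (simp add: homogeneous_harmonic_def poly_intros)
  moreover have "axially_symmetric e (pd e F)"
    unfolding axially_symmetric_def
  proof (intro allI impI)
    fix a b :: 'm and x assume ab: "a \<noteq> e" "b \<noteq> e"
    have "(\<lambda>x. x $ a * pd b F x) = (\<lambda>x. x $ b * pd a F x)"
      using Suc.prems ab by (auto simp: axially_symmetric_def)
    then have "pd e (\<lambda>x. x $ a * pd b F x) x = pd e (\<lambda>x. x $ b * pd a F x) x" by simp
    then show "x $ a * pd b (pd e F) x = x $ b * pd a (pd e F) x"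
      using ab by (simp add: pd_mult poly_intros pd_commute[of F e])
  qed
  ultimately have IH: "pd e F x = pd e F (axis e 1) * zonal n e j x" for x
    by (rule Suc.IH)
  have pole: "pd e F (axis e 1) = real (Suc j) * F (axis e 1)"
    using euler_homogeneous[OF poly hom, of "axis e 1"]
    by (simp add: axis_def if_distrib if_distribR cong: if_cong)
  then have IH': "pd e F x = real (Suc j) * F (axis e 1) * zonal n e j x" for x
    by (subst IH) (simp only: pole)
  define D where "D x = F x - F (axis e 1) * zonal n e (Suc j) x" for x
  have "homogeneous_harmonic (Suc j) D"
    unfolding homogeneous_harmonic_def D_def using hom card
    by (auto simp: poly_intros zonal_homogeneous lap_diff lap_cmult harm lap_zonal algebra_simps
        simp del: zonal.simps)
  moreover have "axially_symmetric e D"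
    using Suc.prems(2) axially_symmetric_zonal[of n e "Suc j"] card
    unfolding axially_symmetric_def D_def
    by (auto simp: pd_diff pd_cmult poly_intros algebra_simps simp del: zonal.simps)
  moreover have "pd e D x = 0" for x
    unfolding D_def using card
    by (simp add: pd_diff pd_cmult poly_intros IH' pd_zonal_pole del: zonal.simps)
  ultimately have "D x = 0"
    by (rule harmonic_cylinder_eq_0[OF _ _ _ card]) simp
  then show ?case by (simp add: D_def)
qed

section \<open>Rotation invariance of the sphere measure\<close>

lemma orthogonal_matrix_inner:
  fixes M :: "real ^ 'm ^ 'm::finite"
  assumes "orthogonal_matrix M"
  shows "(M *v x) \<bullet> (M *v y) = x \<bullet> y"
proof -
  have "transpose M *v (M *v x) = x"
    using assms by (simp only: matrix_vector_mul_assoc orthogonal_matrix_def matrix_vector_mul_lid)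
  then show ?thesis by (simp flip: dot_lmul_matrix)
qed

lemma orthogonal_matrix_norm:
  fixes M :: "real ^ 'm ^ 'm::finite"
  assumes "orthogonal_matrix M"
  shows "norm (M *v x) = norm x"
  by (simp add: norm_eq_sqrt_inner orthogonal_matrix_inner[OF assms])

lemma borel_measurable_matrix_vector [measurable]:
  fixes M :: "real ^ 'm ^ 'm::finite"
  assumes "f \<in> borel_measurable N"
  shows "(\<lambda>x. M *v f x) \<in> borel_measurable N"
proof -
  have "(\<lambda>x. M *v x) \<in> borel_measurable borel"
    by (intro borel_measurable_continuous_onI matrix_vector_mult_linear_continuous_on)
  from measurable_compose[OF assms this] show ?thesis .
qed

lemma nn_integral_lborel_shift:
  fixes f :: "'a::euclidean_space \<Rightarrow> ennreal"
  assumes [measurable]: "f \<in> borel_measurable borel"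
  shows "(\<integral>\<^sup>+x. f (x + c) \<partial>lborel) = (\<integral>\<^sup>+x. f x \<partial>lborel)"
proof -
  have "(\<integral>\<^sup>+x. f x \<partial>lborel) = (\<integral>\<^sup>+x. f x \<partial>distr lborel borel ((+) c))"
    by (simp add: lborel_distr_plus)
  also have "\<dots> = (\<integral>\<^sup>+x. f (c + x) \<partial>lborel)"
    by (subst nn_integral_distr) auto
  finally show ?thesis by (simp add: add.commute)
qed

lemma unit_ball_emeasure:
  "emeasure lborel (ball (0 :: real ^ 'm::finite) 1) \<noteq> 0" "emeasure lborel (ball (0 :: real ^ 'm) 1) \<noteq> \<infinity>"
  using emeasure_lborel_ball_finite[of "0 :: real ^ 'm" 1] content_ball_pos[of 1 "0 :: real ^ 'm"]
  by (auto simp: measure_def)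

text \<open>
  Uniqueness of Haar measure in a special case.  For the unit ball \<open>B\<close>, both sides are
  compared through the double integral of \<open>1\<^sub>B(x) 1\<^sub>A(M z)\<close>.  Shifting \<open>z\<close> by \<open>M\<^sup>T x\<close> and
  then \<open>x\<close> by \<open>- M z\<close> turns the integrand into \<open>1\<^sub>B(x - M z) 1\<^sub>A(x)\<close>; as \<open>M\<close> preserves
  norms, the inner integral over \<open>z\<close> is the volume of a translate of \<open>B\<close>.
\<close>

lemma lborel_distr_orthogonal:
  fixes M :: "real ^ 'm ^ 'm::finite"
  assumes M: "orthogonal_matrix M"
  shows "distr lborel borel (\<lambda>x. M *v x) = lborel"
proof (rule measure_eqI)
  fix A :: "(real ^ 'm) set"
  assume "A \<in> sets (distr lborel borel (\<lambda>x. M *v x))"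
  then have [measurable]: "A \<in> sets borel" by simp
  have [measurable]: "ball (0 :: real ^ 'm) 1 \<in> sets borel" by (intro borel_open open_ball)
  let ?b = "indicator (ball 0 1) :: real ^ 'm \<Rightarrow> ennreal"
  let ?a = "indicator A :: real ^ 'm \<Rightarrow> ennreal"
  let ?B = "emeasure lborel (ball (0 :: real ^ 'm) 1)"
  have MT: "M *v (transpose M *v x) = x" for x
    using M by (simp only: matrix_vector_mul_assoc orthogonal_matrix_def matrix_vector_mul_lid)
  have "(\<integral>\<^sup>+x. \<integral>\<^sup>+z. ?b x * ?a (M *v z) \<partial>lborel \<partial>lborel)
      = (\<integral>\<^sup>+x. \<integral>\<^sup>+z. ?b x * ?a (M *v (z + transpose M *v x)) \<partial>lborel \<partial>lborel)"
    by (rule nn_integral_cong,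
        rule nn_integral_lborel_shift[where f = "\<lambda>z. ?b x * ?a (M *v z)" for x, symmetric]) measurable
  also have "\<dots> = (\<integral>\<^sup>+x. \<integral>\<^sup>+z. ?b x * ?a (M *v z + x) \<partial>lborel \<partial>lborel)"
    by (simp only: matrix_vector_right_distrib MT)
  also have "\<dots> = (\<integral>\<^sup>+z. \<integral>\<^sup>+x. ?b x * ?a (M *v z + x) \<partial>lborel \<partial>lborel)"
    by (intro lborel_pair.Fubini') measurable
  also have "\<dots> = (\<integral>\<^sup>+z. \<integral>\<^sup>+x. ?b (x + - (M *v z)) * ?a (M *v z + (x + - (M *v z))) \<partial>lborel \<partial>lborel)"
    by (rule nn_integral_cong,
        rule nn_integral_lborel_shift[where f = "\<lambda>x. ?b x * ?a (M *v z + x)" for z, symmetric]) measurable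
  also have "\<dots> = (\<integral>\<^sup>+x. \<integral>\<^sup>+z. ?b (x - M *v z) * ?a x \<partial>lborel \<partial>lborel)"
    by (subst lborel_pair.Fubini') simp_all
  also have "\<dots> = (\<integral>\<^sup>+x. \<integral>\<^sup>+z. ?b (z - transpose M *v x) * ?a x \<partial>lborel \<partial>lborel)"
  proof -
    have "norm (x - M *v z) = norm (z - transpose M *v x)" for x z
      using orthogonal_matrix_norm[OF M, of "z - transpose M *v x"]
      unfolding matrix_vector_mult_diff_distrib MT by (simp add: norm_minus_commute)
    then have "?b (x - M *v z) = ?b (z - transpose M *v x)" for x z
      by (simp add: indicator_def)
    then show ?thesis by simp
  qed
  also have "\<dots> = (\<integral>\<^sup>+x. \<integral>\<^sup>+z. ?b z * ?a x \<partial>lborel \<partial>lborel)"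
    using nn_integral_lborel_shift[of "\<lambda>z. ?b z * ?a x" "- (transpose M *v x)" for x] by simp
  finally have "(\<integral>\<^sup>+x. ?b x * (\<integral>\<^sup>+z. ?a (M *v z) \<partial>lborel) \<partial>lborel) = (\<integral>\<^sup>+x. ?B * ?a x \<partial>lborel)"
    by (simp add: nn_integral_cmult nn_integral_multc)
  then have "?B * (\<integral>\<^sup>+z. ?a (M *v z) \<partial>lborel) = ?B * emeasure lborel A"
    by (simp add: nn_integral_cmult nn_integral_multc)
  moreover have "(\<integral>\<^sup>+z. ?a (M *v z) \<partial>lborel) = emeasure (distr lborel borel (\<lambda>x. M *v x)) A"
  proof -
    have "(\<integral>\<^sup>+z. ?a (M *v z) \<partial>lborel) = (\<integral>\<^sup>+z. ?a z \<partial>distr lborel borel (\<lambda>x. M *v x))"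
      by (subst nn_integral_distr) auto
    then show ?thesis by simp
  qed
  moreover note unit_ball_emeasure[where 'm = 'm]
  ultimately show "emeasure (distr lborel borel (\<lambda>x. M *v x)) A = emeasure lborel A"
    by (simp add: ennreal_mult_cancel_left)
qed simp

text \<open>
  The source of the radial projection in \<open>sphere_measure\<close>; the projection commutes with
  orthogonal maps, so invariance of the sphere measure follows from invariance of this
  measure.
\<close>

definition unit_ball_measure :: "(real ^ 'm::finite) measure" where
  "unit_ball_measure = uniform_measure lborel (ball 0 1)"

lemma sets_unit_ball_measure [measurable_cong, simp]: "sets unit_ball_measure = sets borel"
  by (simp add: unit_ball_measure_def)

lemma prob_space_unit_ball_measure: "prob_space (unit_ball_measure :: (real ^ 'm::finite) measure)"
  unfolding unit_ball_measure_def by (rule prob_space_uniform_measure[OF unit_ball_emeasure])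

lemma unit_ball_measure_distr_orthogonal:
  fixes M :: "real ^ 'm ^ 'm::finite"
  assumes M: "orthogonal_matrix M"
  shows "distr unit_ball_measure borel (\<lambda>x. M *v x) = unit_ball_measure"
proof (rule measure_eqI)
  fix A :: "(real ^ 'm) set"
  assume "A \<in> sets (distr unit_ball_measure borel (\<lambda>x. M *v x))"
  then have A [measurable]: "A \<in> sets borel" by simp
  have pre [measurable]: "(\<lambda>x. M *v x) -` A \<in> sets borel"
    using measurable_sets[OF borel_measurable_matrix_vector[OF measurable_ident_sets[OF refl]] A] by simp
  have "ball 0 1 \<inter> (\<lambda>x. M *v x) -` A = (\<lambda>x. M *v x) -` (ball 0 1 \<inter> A)"
    by (auto simp: orthogonal_matrix_norm[OF M])
  then have "emeasure lborel (ball 0 1 \<inter> (\<lambda>x. M *v x) -` A)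
      = emeasure (distr lborel borel (\<lambda>x. M *v x)) (ball 0 1 \<inter> A)"
    by (subst emeasure_distr) auto
  then have "emeasure lborel (ball 0 1 \<inter> (\<lambda>x. M *v x) -` A) = emeasure lborel (ball 0 1 \<inter> A)"
    by (simp add: lborel_distr_orthogonal[OF M])
  then show "emeasure (distr unit_ball_measure borel (\<lambda>x. M *v x)) A = emeasure unit_ball_measure A"
    using pre by (subst emeasure_distr) (auto simp: unit_ball_measure_def)
qed simp

lemma sgn_borel [measurable]: "(sgn :: real ^ 'm::finite \<Rightarrow> _) \<in> borel_measurable borel"
  unfolding sgn_div_norm by measurable

lemma sphere_borel [measurable]: "sphere (a :: real ^ 'm::finite) b \<in> sets borel"
  by (intro borel_closed closed_sphere)

lemma prob_space_sphere_measure: "prob_space (sphere_measure :: (real ^ 'm::finite) measure)"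
proof
  interpret U: prob_space "unit_ball_measure :: (real ^ 'm) measure"
    by (rule prob_space_unit_ball_measure)
  \<comment> \<open>\<open>sgn\<close> sends the origin to itself, which is the only point not projected to the sphere.\<close>
  have null: "emeasure unit_ball_measure {0 :: real ^ 'm} = 0"
    using emeasure_mono[of "ball 0 1 \<inter> {0}" "{0 :: real ^ 'm}" lborel]
    by (simp add: unit_ball_measure_def)
  have "emeasure sphere_measure (space (sphere_measure :: (real ^ 'm) measure))
      = emeasure (distr unit_ball_measure borel sgn) (sphere (0 :: real ^ 'm) 1)"
    unfolding sphere_measure_def unit_ball_measure_def[symmetric]
    by (subst emeasure_restrict_space) (auto simp: space_restrict_space)
  also have "\<dots> = emeasure unit_ball_measure (UNIV - {0 :: real ^ 'm})"
    by (subst emeasure_distr) (auto intro!: arg_cong[where f="emeasure _"] simp: norm_sgn sets_eq_imp_space_eq[OF sets_unit_ball_measure])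
  also have "\<dots> = 1"
    using null U.emeasure_space_1 by (subst emeasure_Diff) (auto simp: sets_eq_imp_space_eq[OF sets_unit_ball_measure])
  finally show "emeasure sphere_measure (space (sphere_measure :: (real ^ 'm) measure)) = 1" .
qed

lemma space_sphere_measure [simp]: "space sphere_measure = sphere 0 1"
  by (simp add: sphere_measure_def space_restrict_space)

lemma integral_sphere_measure:
  fixes f :: "real ^ 'm::finite \<Rightarrow> real"
  assumes [measurable]: "f \<in> borel_measurable borel"
  shows "(\<integral>x. f x \<partial>sphere_measure) = (\<integral>x. indicator (sphere 0 1) (sgn x) * f (sgn x) \<partial>unit_ball_measure)"
  unfolding sphere_measure_def unit_ball_measure_def[symmetric]
  by (subst integral_restrict_space) (auto simp: integral_distr)

lemma integral_sphere_measure_orthogonal: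
  fixes M :: "real ^ 'm ^ 'm::finite" and f :: "real ^ 'm \<Rightarrow> real"
  assumes M: "orthogonal_matrix M" and [measurable]: "f \<in> borel_measurable borel"
  shows "(\<integral>x. f (M *v x) \<partial>sphere_measure) = (\<integral>x. f x \<partial>sphere_measure)"
proof -
  let ?h = "\<lambda>x. indicator (sphere 0 1) (sgn x) * f (sgn x)"
  have "sgn (M *v x) = M *v sgn x" for x
    by (simp add: sgn_div_norm orthogonal_matrix_norm[OF M] matrix_vector_mult_scaleR)
  then have eq: "?h (M *v x) = indicator (sphere 0 1) (sgn x) * f (M *v sgn x)" for x
    by (simp add: indicator_def orthogonal_matrix_norm[OF M])
  have "(\<integral>x. f (M *v x) \<partial>sphere_measure) = (\<integral>x. ?h (M *v x) \<partial>unit_ball_measure)"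
    unfolding eq by (rule integral_sphere_measure) measurable
  also have "\<dots> = (\<integral>x. ?h x \<partial>distr unit_ball_measure borel (\<lambda>x. M *v x))"
    by (subst integral_distr) auto
  also have "\<dots> = (\<integral>x. f x \<partial>sphere_measure)"
    by (simp add: unit_ball_measure_distr_orthogonal[OF M] integral_sphere_measure)
  finally show ?thesis .
qed

lemma integrable_sphere_measure:
  fixes f :: "real ^ 'm::finite \<Rightarrow> real"
  assumes "continuous_on UNIV f"
  shows "integrable sphere_measure f"
proof -
  interpret prob_space "sphere_measure :: (real ^ 'm) measure"
    by (rule prob_space_sphere_measure)
  have "bounded (f ` sphere 0 1)"
    using assms by (intro compact_imp_bounded compact_continuous_image) (auto intro: continuous_on_subset)
  then obtain B where "\<forall>y\<in>f ` sphere 0 1. norm y \<le> B"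
    unfolding bounded_iff by blast
  then have B: "\<And>x. x \<in> sphere 0 1 \<Longrightarrow> norm (f x) \<le> B" by blast
  have "f \<in> borel_measurable borel" using assms by (rule borel_measurable_continuous_onI)
  then have "f \<in> borel_measurable sphere_measure"
    unfolding sphere_measure_def by (intro measurable_restrict_space1) simp
  then show ?thesis
    using B by (intro integrable_const_bound[where B=B]) auto
qed

lemma continuous_on_poly_fun: "poly_fun F \<Longrightarrow> continuous_on UNIV F"
  by (simp add: continuous_at_imp_continuous_on continuous_real_polymonial_function)

lemma integrable_poly_fun: "poly_fun F \<Longrightarrow> integrable sphere_measure F"
  by (intro integrable_sphere_measure continuous_on_poly_fun)

section \<open>Separable functions and the norm of the zonal harmonic\<close>

text \<open>
  Finite sums of products of a coefficient \<open>c u\<close> from a prescribed class and a polynomial in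
  \<open>w\<close>.  Composing a polynomial with a matrix that depends on a parameter \<open>u\<close> gives such a
  sum, and integrals over \<open>u\<close> or over \<open>w\<close> act on the two factors separately.  So linearity
  suffices to exchange them with each other and with derivatives.  Continuous coefficients
  serve for the means over a group, differentiable ones for one-parameter groups of
  rotations.
\<close>

inductive separable :: "('a \<Rightarrow> real) set \<Rightarrow> ('a \<Rightarrow> real ^ 'm::finite \<Rightarrow> real) \<Rightarrow> bool"
  for C :: "('a \<Rightarrow> real) set" where
  separable_prod: "c \<in> C \<Longrightarrow> poly_fun q \<Longrightarrow> separable C (\<lambda>u w. c u * q w)"
| separable_add: "separable C F \<Longrightarrow> separable C G \<Longrightarrow> separable C (\<lambda>u w. F u w + G u w)"

definition unital_mult_closed :: "('a \<Rightarrow> real) set \<Rightarrow> bool" where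
  "unital_mult_closed C \<longleftrightarrow> (\<lambda>u. 1) \<in> C \<and> (\<forall>c\<in>C. \<forall>d\<in>C. (\<lambda>u. c u * d u) \<in> C)"

lemma separable_mult:
  assumes C: "unital_mult_closed C" and F: "separable C F" and G: "separable C G"
  shows "separable C (\<lambda>u w. F u w * G u w)"
  using F
proof induction
  case (separable_prod c q)
  note cq = this
  from G show ?case
  proof induction
    case (separable_prod d p)
    have "separable C (\<lambda>u w. (c u * d u) * (q w * p w))"
      using cq separable_prod C
      by (intro separable.separable_prod) (auto simp: unital_mult_closed_def intro: poly_intros)
    then show ?case by (simp add: mult_ac)
  next
    case (separable_add G H)
    from separable.separable_add[OF this(3,4)] show ?case by (simp add: algebra_simps)
  qed
next
  case (separable_add F H)
  from separable.separable_add[OF this(3,4)] show ?case by (simp add: algebra_simps)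
qed

lemma separable_poly: "unital_mult_closed C \<Longrightarrow> poly_fun q \<Longrightarrow> separable C (\<lambda>u. q)"
  using separable_prod[of "\<lambda>u. 1" C q] by (simp add: unital_mult_closed_def)

lemma separable_sum:
  assumes "unital_mult_closed C" "finite I" "\<And>i. i \<in> I \<Longrightarrow> separable C (F i)"
  shows "separable C (\<lambda>u w. \<Sum>i\<in>I. F i u w)"
  using assms(2,3)
  by induction (auto intro: separable_poly[OF assms(1)] separable_add poly_intros)

lemma separable_compose:
  assumes C: "unital_mult_closed C" and "poly_fun p" and T: "\<And>b. separable C (\<lambda>u w. T u w $ b)"
  shows "separable C (\<lambda>u w. p (T u w))"
  using assms(2)
proof induction
  case (linear f)
  show ?case
    by (subst linear_expansion[OF linear])
      (intro separable_sum separable_mult separable_poly C T poly_intros finite)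
next
  case (const d)
  show ?case by (intro separable_poly C poly_intros)
next
  case (add f g)
  then show ?case by (intro separable_add)
next
  case (mult f g)
  then show ?case by (intro separable_mult C)
qed

lemma poly_fun_separable: "separable C F \<Longrightarrow> poly_fun (F u)"
  by (induction rule: separable.induct) (auto intro!: poly_intros)

lemma separable_pd: "separable C F \<Longrightarrow> separable C (\<lambda>u. pd e (F u))"
proof (induction rule: separable.induct)
  case (separable_prod c q)
  then show ?case by (simp add: pd_cmult separable.separable_prod poly_intros)
next
  case (separable_add F G)
  then show ?case
    by (simp add: pd_add poly_fun_separable[OF separable_add(1)] poly_fun_separable[OF separable_add(2)]
        separable.separable_add)
qed

lemma separable_integrable:
  assumes C: "\<And>c. c \<in> C \<Longrightarrow> integrable \<mu> c" and "separable C F"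
  shows "integrable \<mu> (\<lambda>u. F u w)"
  using assms(2) by (induction rule: separable.induct) (auto intro: C)

lemma separable_mean:
  assumes C: "\<And>c. c \<in> C \<Longrightarrow> integrable \<mu> c" and "separable C F"
  shows "poly_fun (\<lambda>w. \<integral>u. F u w \<partial>\<mu>)"
    and "pd e (\<lambda>w. \<integral>u. F u w \<partial>\<mu>) = (\<lambda>w. \<integral>u. pd e (F u) w \<partial>\<mu>)"
proof -
  have "poly_fun (\<lambda>w. \<integral>u. F u w \<partial>\<mu>) \<and>
    pd e (\<lambda>w. \<integral>u. F u w \<partial>\<mu>) = (\<lambda>w. \<integral>u. pd e (F u) w \<partial>\<mu>)"
    using assms(2)
  proof (induction rule: separable.induct)
    case (separable_prod c q)
    then show ?case by (simp add: pd_cmult poly_intros)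
  next
    case (separable_add F G)
    have "integrable \<mu> (\<lambda>u. F u w)" "integrable \<mu> (\<lambda>u. G u w)"
      "integrable \<mu> (\<lambda>u. pd e (F u) w)" "integrable \<mu> (\<lambda>u. pd e (G u) w)" for w
      using separable_add(1,2) separable_pd[of C F e] separable_pd[of C G e]
      by (auto intro: separable_integrable[OF C])
    with separable_add(3,4) show ?case
      by (auto simp add: pd_add poly_intros poly_fun_separable[OF separable_add(1)]
          poly_fun_separable[OF separable_add(2)])
  qed
  then show "poly_fun (\<lambda>w. \<integral>u. F u w \<partial>\<mu>)"
    and "pd e (\<lambda>w. \<integral>u. F u w \<partial>\<mu>) = (\<lambda>w. \<integral>u. pd e (F u) w \<partial>\<mu>)" by auto
qed

lemma sphere_integral_cong:
  "(\<And>w. w \<bullet> w = 1 \<Longrightarrow> f w = g w) \<Longrightarrow> (\<integral>w. f w \<partial>sphere_measure) = (\<integral>w. g w \<partial>sphere_measure)"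
  by (intro Bochner_Integration.integral_cong) (auto simp: norm_eq_1)

lemma separable_fubini:
  assumes C: "\<And>c. c \<in> C \<Longrightarrow> integrable \<mu> c" and "separable C F" and "poly_fun h"
  shows "integrable \<mu> (\<lambda>u. \<integral>w. F u w * h w \<partial>sphere_measure) \<and>
    (\<integral>w. (\<integral>u. F u w \<partial>\<mu>) * h w \<partial>sphere_measure) = (\<integral>u. (\<integral>w. F u w * h w \<partial>sphere_measure) \<partial>\<mu>)"
  using assms(2)
proof (induction rule: separable.induct)
  case (separable_prod c q)
  then show ?case using C by (simp add: mult.assoc)
next
  case (separable_add F G)
  have int: "integrable sphere_measure (\<lambda>w. F u w * h w)" "integrable sphere_measure (\<lambda>w. G u w * h w)" for u
    using separable_add(1,2)[THEN poly_fun_separable] assms(3)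
    by (auto intro!: integrable_poly_fun poly_intros)
  have int2: "integrable sphere_measure (\<lambda>w. (\<integral>u. F u w \<partial>\<mu>) * h w)"
    "integrable sphere_measure (\<lambda>w. (\<integral>u. G u w \<partial>\<mu>) * h w)"
    using separable_mean(1)[OF C separable_add(1)] separable_mean(1)[OF C separable_add(2)] assms(3)
    by (auto intro!: integrable_poly_fun poly_intros)
  have int3: "integrable \<mu> (\<lambda>u. F u w)" "integrable \<mu> (\<lambda>u. G u w)" for w
    using separable_integrable[OF C separable_add(1)] separable_integrable[OF C separable_add(2)] by auto
  show ?case using separable_add(3,4) by (simp add: distrib_right int int2 int3)
qed

text \<open>
  The differentiability of all \<open>F u w\<close> in \<open>u\<close> and the polynomial form of their derivative
  are part of the statement because the induction step for sums needs them.
\<close>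

lemma separable_sphere_derivative:
  assumes C: "\<And>c. c \<in> C \<Longrightarrow> c differentiable (at u)" and "separable C F"
  shows "(\<forall>w. (\<lambda>u. F u w) field_differentiable (at u)) \<and> poly_fun (\<lambda>w. deriv (\<lambda>u. F u w) u) \<and>
    ((\<lambda>u. \<integral>w. F u w \<partial>sphere_measure) has_real_derivative
       (\<integral>w. deriv (\<lambda>u. F u w) u \<partial>sphere_measure)) (at u)"
  using assms(2)
proof (induction rule: separable.induct)
  case (separable_prod c q)
  have c: "(c has_real_derivative deriv c u) (at u)"
    using C[OF separable_prod(1)] DERIV_deriv_iff_real_differentiable by blast
  then have d: "((\<lambda>u. c u * q w) has_real_derivative deriv c u * q w) (at u)" for w
    by (rule DERIV_cmult_right)
  then have "deriv (\<lambda>u. c u * q w) u = deriv c u * q w" for w by (rule DERIV_imp_deriv)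
  then show ?case using d c separable_prod(2)
    by (auto intro!: poly_intros derivative_eq_intros simp: field_differentiable_def)
next
  case (separable_add F G)
  have int: "integrable sphere_measure (F u)" "integrable sphere_measure (G u)" for u
    using separable_add(1,2)[THEN poly_fun_separable] by (auto intro!: integrable_poly_fun)
  have d: "deriv (\<lambda>u. F u w + G u w) u = deriv (\<lambda>u. F u w) u + deriv (\<lambda>u. G u w) u" for w
    using separable_add by (intro deriv_add) auto
  have "integrable sphere_measure (\<lambda>w. deriv (\<lambda>u. F u w) u)"
    "integrable sphere_measure (\<lambda>w. deriv (\<lambda>u. G u w) u)"
    using separable_add by (auto intro!: integrable_poly_fun)
  then show ?case using separable_add(3,4)
    by (auto simp: int d intro!: poly_intros derivative_eq_intros field_differentiable_add)
qed

text \<open>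
  The rotation in the plane of the coordinates \<open>a\<close> and \<open>b\<close>, with the orientation of
  \<open>plane_rotation\<close>.
\<close>

definition givens :: "'m::finite \<Rightarrow> 'm \<Rightarrow> real \<Rightarrow> real ^ 'm ^ 'm" where
  "givens a b \<theta> = (\<chi> i j.
     if i = a \<and> j = a then cos \<theta> else if i = a \<and> j = b then sin \<theta>
     else if i = b \<and> j = a then - sin \<theta> else if i = b \<and> j = b then cos \<theta>
     else if i = j then 1 else 0)"

lemma givens_nth:
  assumes "a \<noteq> b"
  shows "(givens a b \<theta> *v w) $ i =
    (if i = a then cos \<theta> * w $ a + sin \<theta> * w $ b
     else if i = b then - sin \<theta> * w $ a + cos \<theta> * w $ b else w $ i)"
proof -
  have "(givens a b \<theta> *v w) $ i = (\<Sum>j\<in>UNIV. givens a b \<theta> $ i $ j * w $ j)"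
    by (simp add: matrix_vector_mult_def)
  also have "\<dots> = (\<Sum>j\<in>UNIV.
      (if j = a then (if i = a then cos \<theta> * w $ a else if i = b then - sin \<theta> * w $ a else 0) else 0) +
      (if j = b then (if i = a then sin \<theta> * w $ b else if i = b then cos \<theta> * w $ b else 0) else 0) +
      (if j = i then (if i = a \<or> i = b then 0 else w $ i) else 0))"
    using assms by (intro sum.cong refl) (auto simp: givens_def)
  also have "\<dots> = (if i = a then cos \<theta> * w $ a + sin \<theta> * w $ b
     else if i = b then - sin \<theta> * w $ a + cos \<theta> * w $ b else w $ i)"
    using assms by (simp add: sum.distrib)
  finally show ?thesis .
qed

lemma givens_mult: "a \<noteq> b \<Longrightarrow> givens a b \<theta> ** givens a b \<phi> = givens a b (\<theta> + \<phi>)"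
  unfolding matrix_eq matrix_vector_mul_assoc[symmetric] vec_eq_iff
  by (simp add: givens_nth cos_add sin_add algebra_simps)

lemma givens_0: "a \<noteq> b \<Longrightarrow> givens a b 0 = mat 1"
  unfolding matrix_eq vec_eq_iff by (simp add: givens_nth)

lemma transpose_givens: "a \<noteq> b \<Longrightarrow> transpose (givens a b \<theta>) = givens a b (- \<theta>)"
proof -
  assume ab: "a \<noteq> b"
  have "givens a b \<theta> $ j $ i = givens a b (- \<theta>) $ i $ j" for i j
    using ab by (cases "i = a"; cases "i = b"; cases "j = a"; cases "j = b") (simp_all add: givens_def)
  then show ?thesis by (simp add: vec_eq_iff transpose_def)
qed

lemma orthogonal_givens: "a \<noteq> b \<Longrightarrow> orthogonal_matrix (givens a b \<theta>)"
  by (simp add: orthogonal_matrix transpose_givens givens_mult givens_0)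

lemma rotation_givens:
  assumes "a \<noteq> b"
  shows "rotation_matrix (givens a b \<theta>)"
proof -
  \<comment> \<open>The rotation is the square of the rotation by half the angle, so its determinant is a
    square of \<open>1\<close> or \<open>-1\<close>.\<close>
  have "det (givens a b \<theta>) = det (givens a b (\<theta> / 2)) * det (givens a b (\<theta> / 2))"
    using givens_mult[OF assms, of "\<theta> / 2" "\<theta> / 2"] by (simp flip: det_mul)
  moreover have "det (givens a b (\<theta> / 2)) = 1 \<or> det (givens a b (\<theta> / 2)) = -1"
    by (rule det_orthogonal_matrix[OF orthogonal_givens[OF assms]])
  ultimately show ?thesis
    by (auto simp: rotation_matrix_def orthogonal_givens[OF assms])
qed

lemma givens_derivative:
  assumes "a \<noteq> b" "poly_fun g"
  shows "((\<lambda>\<phi>. g (givens a b \<phi> *v w)) has_real_derivative (w $ b * pd a g w - w $ a * pd b g w)) (at 0)"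
proof -
  have "((\<lambda>\<phi>. g (givens a b \<phi> *v w)) has_real_derivative
      (\<Sum>i\<in>UNIV. (if i = a then w $ b else if i = b then - w $ a else 0) * pd i g (givens a b 0 *v w))) (at 0)"
    using assms by (intro poly_fun_chain_rule) (auto simp: givens_nth intro!: derivative_eq_intros)
  moreover have "(\<Sum>i\<in>UNIV. (if i = a then w $ b else if i = b then - w $ a else 0) * pd i g (givens a b 0 *v w))
     = (\<Sum>i\<in>UNIV. (if i = a then w $ b * pd a g w else 0) + (if i = b then - w $ a * pd b g w else 0))"
    using assms by (intro sum.cong) (auto simp: givens_0)
  ultimately show ?thesis by (simp add: sum.distrib)
qed

text \<open>
  The integral of \<open>g\<close> over the rotated sphere does not depend on the angle; this is its
  derivative at the angle 0.
\<close>

lemma sphere_integral_rotation_generator: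
  assumes "a \<noteq> b" "poly_fun g"
  shows "(\<integral>w. w $ b * pd a g w - w $ a * pd b g w \<partial>sphere_measure) = 0"
proof -
  define C where "C = {c :: real \<Rightarrow> real. c differentiable (at 0)}"
  have C: "unital_mult_closed C" by (auto simp: unital_mult_closed_def C_def)
  have trig: "cos \<in> C" "sin \<in> C" "(\<lambda>u. - sin u) \<in> C"
    unfolding C_def by (auto intro!: differentiableI derivative_eq_intros simp: real_differentiable_def)
  have "separable C (\<lambda>\<phi> w. (givens a b \<phi> *v w) $ i)" for i
  proof -
    have "separable C (\<lambda>\<phi> w. cos \<phi> * w $ a + sin \<phi> * w $ b)"
      "separable C (\<lambda>\<phi> w. - sin \<phi> * w $ a + cos \<phi> * w $ b)" "separable C (\<lambda>\<phi> w. w $ i)"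
      by (rule separable_add[OF separable_prod[OF trig(1) poly_fun_nth] separable_prod[OF trig(2) poly_fun_nth]]
          separable_add[OF separable_prod[OF trig(3) poly_fun_nth] separable_prod[OF trig(1) poly_fun_nth]]
          separable_poly[OF C poly_fun_nth])+
    then show ?thesis unfolding givens_nth[OF assms(1)] by (cases "i = a"; cases "i = b") simp_all
  qed
  then have "separable C (\<lambda>\<phi> w. g (givens a b \<phi> *v w))"
    by (rule separable_compose[OF C assms(2)])
  from separable_sphere_derivative[OF _ this, of 0]
  have "((\<lambda>\<phi>. \<integral>w. g (givens a b \<phi> *v w) \<partial>sphere_measure) has_real_derivative
       (\<integral>w. deriv (\<lambda>\<phi>. g (givens a b \<phi> *v w)) 0 \<partial>sphere_measure)) (at 0)"
    by (auto simp: C_def)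
  moreover have "(\<integral>w. g (givens a b \<phi> *v w) \<partial>sphere_measure) = (\<integral>w. g w \<partial>sphere_measure)" for \<phi>
    using assms by (intro integral_sphere_measure_orthogonal orthogonal_givens
        borel_measurable_continuous_onI continuous_on_poly_fun)
  ultimately have "(\<integral>w. deriv (\<lambda>\<phi>. g (givens a b \<phi> *v w)) 0 \<partial>sphere_measure) = 0"
    using DERIV_unique[OF _ DERIV_const] by auto
  then show ?thesis
    using DERIV_imp_deriv[OF givens_derivative[OF assms]] by simp
qed

text \<open>
  Apply the previous lemma to \<open>w $ a * F w\<close> for all planes \<open>(a, e)\<close> and add up.  The terms
  collect to \<open>n w\<^sub>e F + w\<^sub>e (deg F) F - |w|\<^sup>2 \<partial>\<^sub>e F\<close> by Euler's identity.
\<close>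

lemma sphere_integral_by_parts:
  fixes F :: "real ^ 'm::finite \<Rightarrow> real"
  assumes card: "CARD('m) = n + 1" and F: "poly_fun F" and hom: "\<And>s x. F (s *\<^sub>R x) = s ^ j * F x"
  shows "(\<integral>w. pd e F w \<partial>sphere_measure) = real (n + j) * (\<integral>w. w $ e * F w \<partial>sphere_measure)"
proof -
  have [poly_intros]: "poly_fun F" by fact
  let ?L = "\<lambda>a w. w $ e * pd a (\<lambda>w. w $ a * F w) w - w $ a * pd e (\<lambda>w. w $ a * F w) w"
  have "0 = (\<Sum>a\<in>UNIV - {e}. \<integral>w. ?L a w \<partial>sphere_measure)"
    using sphere_integral_rotation_generator[of _ e] by (intro sum.neutral[symmetric]) (auto intro!: poly_intros)
  also have "\<dots> = (\<integral>w. (\<Sum>a\<in>UNIV - {e}. ?L a w) \<partial>sphere_measure)"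
    by (intro Bochner_Integration.integral_sum[symmetric] integrable_poly_fun poly_intros)
  also have "\<dots> = (\<integral>w. real (n + j) * (w $ e * F w) - pd e F w \<partial>sphere_measure)"
  proof (rule sphere_integral_cong)
    fix w :: "real ^ 'm" assume w: "w \<bullet> w = 1"
    have sq: "(\<Sum>a\<in>UNIV - {e}. w $ a * w $ a) = 1 - w $ e * w $ e"
      using w by (simp add: inner_vec_def sum.remove[of UNIV e])
    have eu: "(\<Sum>a\<in>UNIV - {e}. w $ a * pd a F w) = real j * F w - w $ e * pd e F w"
      using euler_homogeneous[OF F hom, of w] by (simp add: sum.remove[of UNIV e])
    have "(\<Sum>a\<in>UNIV - {e}. ?L a w)
       = (\<Sum>a\<in>UNIV - {e}. w $ e * F w + w $ e * (w $ a * pd a F w) - (w $ a * w $ a) * pd e F w)"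
      by (intro sum.cong) (auto simp: pd_mult poly_intros algebra_simps)
    also have "\<dots> = real n * (w $ e * F w) + w $ e * (\<Sum>a\<in>UNIV - {e}. w $ a * pd a F w)
        - (\<Sum>a\<in>UNIV - {e}. w $ a * w $ a) * pd e F w"
      by (simp add: sum.distrib sum_subtractf card sum_distrib_left sum_distrib_right)
    also have "\<dots> = real (n + j) * (w $ e * F w) - pd e F w"
      unfolding sq eu by (simp add: algebra_simps)
    finally show "(\<Sum>a\<in>UNIV - {e}. ?L a w) = real (n + j) * (w $ e * F w) - pd e F w" .
  qed
  also have "\<dots> = real (n + j) * (\<integral>w. w $ e * F w \<partial>sphere_measure) - (\<integral>w. pd e F w \<partial>sphere_measure)"
    by (simp add: integrable_poly_fun poly_intros del: of_nat_add)
  finally show ?thesis by simp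
qed

text \<open>
  Let \<open>T\<close> be the integral of \<open>w\<^sub>e Z\<^sub>m Z\<^sub>m\<^sub>+\<^sub>1\<close>.  It has three expressions: through
  integration by parts (\<open>parts\<close>) and through the recurrence applied to either factor
  (\<open>rec\<close>).  Comparing \<open>parts\<close> with the recurrence for \<open>Z\<^sub>m\<^sub>+\<^sub>1\<close> gives \<open>(m + n) J(m, m + 2) =
  m J(m - 1, m + 1)\<close>, hence orthogonality by induction.  The two forms of the recurrence then
  relate the square integrals of \<open>Z\<^sub>m\<close> and \<open>Z\<^sub>m\<^sub>+\<^sub>1\<close>.
\<close>

lemma zonal_square_integral_step:
  fixes e :: "'m::finite"
  assumes card: "CARD('m) = n + 1" "2 \<le> n"
  defines "J \<equiv> \<lambda>i j. \<integral>w. zonal n e i w * zonal n e j w \<partial>sphere_measure"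
  shows "J m (m + 2) = 0"
    and "real (m + n - 1) * real (2 * m + n + 1) * J (m + 1) (m + 1) = real (m + 1) * real (2 * m + n - 1) * J m m"
proof -
  define T where "T i j = (\<integral>w. w $ e * (zonal n e i w * zonal n e j w) \<partial>sphere_measure)" for i j
  have n: "0 < n" using card by simp
  have [simp]: "integrable sphere_measure (\<lambda>w. zonal n e i w * zonal n e j w)" 
    "integrable sphere_measure (\<lambda>w. w $ e * (zonal n e i w * zonal n e j w))" for i j
    by (intro integrable_poly_fun poly_intros)+
  have parts: "real (n + (2 * m + 1)) * T m (m + 1) =
      real m * J (m - 1) (m + 1) + real (m + 1) * J m m" for m
  proof -
    have "pd e (\<lambda>w. zonal n e m w * zonal n e (m + 1) w) =
        (\<lambda>w. real m * (zonal n e (m - 1) w * zonal n e (m + 1) w) + real (m + 1) * (zonal n e m w * zonal n e m w))"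
      using pd_zonal_pole[OF n, of e] 
      by (cases m) (simp_all add: pd_mult poly_intros algebra_simps fun_eq_iff del: zonal.simps(3))
    moreover have "real (n + (2 * m + 1)) * T m (m + 1) = 
        (\<integral>w. pd e (\<lambda>w. zonal n e m w * zonal n e (m + 1) w) w \<partial>sphere_measure)"
      unfolding T_def
      by (rule sphere_integral_by_parts[OF card(1), symmetric])
        (auto intro!: poly_intros simp: zonal_homogeneous power_add power_mult_distrib mult_ac power2_eq_square
          power_mult simp del: zonal.simps)
    ultimately show ?thesis by (simp add: J_def del: of_nat_add of_nat_Suc zonal.simps)
  qed
  have rec: "real (2 * j + n + 1) * T i (j + 1) = real (j + n) * J i (j + 2) + real (j + 1) * J i j" for i j
  proof -
    have "real (2 * j + n + 1) * T i (j + 1)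
        = (\<integral>w. real (2 * j + n + 1) * (w $ e * (zonal n e i w * zonal n e (j + 1) w)) \<partial>sphere_measure)"
      by (simp add: T_def del: of_nat_add of_nat_Suc)
    also have "\<dots> = (\<integral>w. real (j + n) * (zonal n e i w * zonal n e (j + 2) w)
        + real (j + 1) * (zonal n e i w * zonal n e j w) \<partial>sphere_measure)"
    proof (rule sphere_integral_cong)
      fix w :: "real ^ 'm" assume "w \<bullet> w = 1"
      then have "real (2 * j + n + 1) * (w $ e * zonal n e (j + 1) w)
        = real (j + n) * zonal n e (j + 2) w + real (j + 1) * zonal n e j w"
        using zonal_recurrence[OF n, of j e w] by (simp del: zonal.simps)
      from arg_cong[OF this, of "\<lambda>y. zonal n e i w * y"]
      show "real (2 * j + n + 1) * (w $ e * (zonal n e i w * zonal n e (j + 1) w)) =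
        real (j + n) * (zonal n e i w * zonal n e (j + 2) w) + real (j + 1) * (zonal n e i w * zonal n e j w)"
        by (simp only: distrib_left mult.left_commute)
    qed
    also have "\<dots> = real (j + n) * J i (j + 2) + real (j + 1) * J i j"
      by (simp add: J_def del: of_nat_add of_nat_Suc zonal.simps)
    finally show ?thesis .
  qed
  have sym: "J i j = J j i" "T i j = T j i" for i j
    by (simp_all add: J_def T_def mult.commute)
  have orth: "J m (m + 2) = 0" for m
  proof (induction m)
    case 0
    show ?case using parts[of 0] rec[of 0 0] n by simp
  next
    case (Suc m)
    have "real (Suc m + n) * J (Suc m) (Suc m + 2) = 0"
      using parts[of "Suc m"] rec[of "Suc m" "Suc m"] Suc by (simp add: algebra_simps)
    then show ?case using n by (simp del: of_nat_add of_nat_Suc)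
  qed
  then show "J m (m + 2) = 0" .
  have up: "real (2 * m + n - 1) * T m (m + 1) = real (m + n - 1) * J (m + 1) (m + 1)"
  proof (cases m)
    case 0
    then show ?thesis by (simp add: T_def J_def)
  next
    case (Suc i)
    show ?thesis
      using rec[where i = "i + 2" and j = i] orth[of i] Suc
        sym(1)[of "i + 2" i] sym(2)[of "i + 2" "i + 1"] by simp
  qed
  have down: "real (2 * m + n + 1) * T m (m + 1) = real (m + 1) * J m m"
    using rec[of m m] orth[of m] by simp
  show "real (m + n - 1) * real (2 * m + n + 1) * J (m + 1) (m + 1) = real (m + 1) * real (2 * m + n - 1) * J m m"
    using arg_cong[OF up, of "\<lambda>y. real (2 * m + n + 1) * y"] arg_cong[OF down, of "\<lambda>y. real (2 * m + n - 1) * y"]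
    by (simp only: mult_ac)
qed

lemma harmonics_dim_0: "2 \<le> n \<Longrightarrow> harmonics_dim n 0 = 1"
proof -
  assume n: "2 \<le> n"
  have "Gamma (real n) = (real n - 1) * Gamma (real n - 1)"
    using Gamma_plus1[of "real n - 1"] nonpos_Ints_nonpos[of "real n - 1"] n by auto
  moreover have "Gamma (real n) > 0" using n by (intro Gamma_real_pos) auto
  ultimately have "(real n - 1) * Gamma (real n - 1) \<noteq> 0" by linarith
  with \<open>Gamma (real n) = _\<close> show ?thesis by (simp add: harmonics_dim_def)
qed

lemma harmonics_dim_Suc:
  assumes "2 \<le> n"
  shows "real (j + 1) * real (2 * j + n - 1) * harmonics_dim n (j + 1)
       = real (j + n - 1) * real (2 * j + n + 1) * harmonics_dim n j"
proof -
  define g where "g = Gamma (real n + real j - 1)"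
  define f where "f = Gamma (real j + 1)"
  have "Gamma (real n + real j) = (real n + real j - 1) * g"
    using Gamma_plus1[of "real n + real j - 1"]
      nonpos_Ints_nonpos[of "real n + real j - 1"] assms by (auto simp: g_def)
  moreover have "Gamma (real j + 1 + 1) = (real j + 1) * f"
    using Gamma_plus1[of "real j + 1"] nonpos_Ints_nonpos[of "real j + 1"] by (auto simp: f_def)
  moreover have "real (j + 1) = real j + 1" "real n + (real j + 1) - 1 = real n + real j"
    "real n + 2 * (real j + 1) - 1 = real n + 2 * real j + 1" by simp_all
  ultimately have h1: "harmonics_dim n (j + 1) =
      (real n + 2 * real j + 1) * ((real n + real j - 1) * g) / ((real j + 1) * f * Gamma (real n))"
    unfolding harmonics_dim_def by (simp only:)
  have h0: "harmonics_dim n j = (real n + 2 * real j - 1) * g / (f * Gamma (real n))"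
    by (simp add: harmonics_dim_def f_def g_def)
  have "f > 0" "Gamma (real n) > 0"
    using assms by (auto simp: f_def intro!: Gamma_real_pos)
  then have "f \<noteq> 0" "Gamma (real n) \<noteq> 0" by linarith+
  then show ?thesis
    unfolding h0 h1 using assms by (simp add: of_nat_diff divide_simps) (simp add: algebra_simps)
qed

lemma harmonics_dim_pos: "2 \<le> n \<Longrightarrow> 0 < harmonics_dim n j"
  unfolding harmonics_dim_def
  by (intro divide_pos_pos mult_pos_pos Gamma_real_pos) auto

text \<open>
  The step above for the integrals and \<open>harmonics_dim_Suc\<close> for the dimensions have
  reciprocal factors.
\<close>

theorem zonal_square_integral:
  fixes e :: "'m::finite"
  assumes card: "CARD('m) = n + 1" "2 \<le> n"
  shows "(\<integral>w. zonal n e j w * zonal n e j w \<partial>sphere_measure) = 1 / harmonics_dim n j"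
proof (induction j)
  case 0
  interpret prob_space "sphere_measure :: (real ^ 'm) measure"
    by (rule prob_space_sphere_measure)
  show ?case using card prob_space by (simp add: harmonics_dim_0)
next
  case (Suc j)
  define I where "I = (\<integral>w. zonal n e (Suc j) w * zonal n e (Suc j) w \<partial>sphere_measure)"
  define A where "A = real (j + n - 1) * real (2 * j + n + 1)"
  define B where "B = real (j + 1) * real (2 * j + n - 1)"
  have pos: "0 < A" "0 < B" "0 < harmonics_dim n j" "0 < harmonics_dim n (Suc j)"
    using card by (auto simp: A_def B_def harmonics_dim_pos)
  have "A * I = B / harmonics_dim n j"
    using zonal_square_integral_step(2)[OF card, of j e] Suc by (simp add: A_def B_def I_def)
  moreover have "B * harmonics_dim n (Suc j) = A * harmonics_dim n j"
    using harmonics_dim_Suc[OF card(2), of j] by (simp add: A_def B_def)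
  moreover have "A * (I * harmonics_dim n (Suc j)) = (A * I) * harmonics_dim n (Suc j)" by simp
  ultimately have "A * (I * harmonics_dim n (Suc j)) = A * 1"
    using pos by simp
  then have "I * harmonics_dim n (Suc j) = 1" using pos by simp
  then show ?case using pos by (simp add: I_def field_simps)
qed

section \<open>Means over the stabilizer of the pole\<close>

lemma orthogonal_transpose_cancel:
  fixes M :: "real ^ 'm ^ 'm::finite"
  assumes "orthogonal_matrix M"
  shows "transpose M *v (M *v x) = x" and "M *v (transpose M *v x) = x"
  using assms by (simp_all only: matrix_vector_mul_assoc orthogonal_matrix_def matrix_vector_mul_lid)

lemma poly_fun_matrix [poly_intros]:
  fixes M :: "real ^ 'm ^ 'm::finite"
  assumes "poly_fun p"
  shows "poly_fun (\<lambda>w. p (M *v w))"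
  using real_polynomial_function_compose[OF polynomial_function_bounded_linear assms, of "\<lambda>w. M *v w"]
  by (simp add: o_def matrix_vector_mul_bounded_linear)

lemma pd_matrix:
  fixes M :: "real ^ 'm ^ 'm::finite"
  assumes "poly_fun p"
  shows "pd a (\<lambda>w. p (M *v w)) = (\<lambda>w. \<Sum>b\<in>UNIV. M $ b $ a * pd b p (M *v w))"
proof (rule pd_eqI)
  fix x :: "real ^ 'm"
  have entry: "(M *v (x + t *\<^sub>R axis a 1)) $ b = (M *v x) $ b + t * M $ b $ a" for t b
    by (simp add: matrix_vector_right_distrib matrix_vector_mult_scaleR matrix_vector_mult_basis column_def)
  have "((\<lambda>t. p (M *v (x + t *\<^sub>R axis a 1))) has_real_derivative
      (\<Sum>b\<in>UNIV. M $ b $ a * pd b p (M *v (x + 0 *\<^sub>R axis a 1)))) (at 0)"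
    unfolding entry by (intro poly_fun_chain_rule assms) (auto simp: entry intro!: derivative_eq_intros)
  then show "((\<lambda>t. p (M *v (x + t *\<^sub>R axis a 1))) has_real_derivative
      (\<Sum>b\<in>UNIV. M $ b $ a * pd b p (M *v x))) (at 0)" by simp
qed

lemma lap_orthogonal:
  fixes M :: "real ^ 'm ^ 'm::finite"
  assumes p: "poly_fun p" and M: "orthogonal_matrix M"
  shows "lap (\<lambda>w. p (M *v w)) x = lap p (M *v x)"
proof -
  have rows: "(\<Sum>a\<in>UNIV. M $ b $ a * M $ c $ a) = (if b = c then 1 else 0)" for b c
  proof -
    have "(M ** transpose M) $ b $ c = (\<Sum>a\<in>UNIV. M $ b $ a * M $ c $ a)"
      by (simp add: matrix_matrix_mult_def transpose_def)
    then show ?thesis using M by (simp add: orthogonal_matrix_def mat_def)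
  qed
  have "pd a (pd a (\<lambda>w. p (M *v w))) x
      = (\<Sum>b\<in>UNIV. M $ b $ a * (\<Sum>c\<in>UNIV. M $ c $ a * pd c (pd b p) (M *v x)))" for a
    by (simp add: pd_matrix pd_sum pd_cmult p poly_intros)
  then have "lap (\<lambda>w. p (M *v w)) x
      = (\<Sum>a\<in>UNIV. \<Sum>b\<in>UNIV. \<Sum>c\<in>UNIV. (M $ b $ a * M $ c $ a) * pd c (pd b p) (M *v x))"
    by (simp add: lap_def sum_distrib_left mult.assoc)
  also have "\<dots> = (\<Sum>b\<in>UNIV. \<Sum>a\<in>UNIV. \<Sum>c\<in>UNIV. (M $ b $ a * M $ c $ a) * pd c (pd b p) (M *v x))"
    by (rule sum.swap)
  also have "\<dots> = (\<Sum>b\<in>UNIV. \<Sum>c\<in>UNIV. \<Sum>a\<in>UNIV. (M $ b $ a * M $ c $ a) * pd c (pd b p) (M *v x))"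
    by (intro sum.cong refl sum.swap)
  also have "\<dots> = (\<Sum>b\<in>UNIV. \<Sum>c\<in>UNIV. (if b = c then 1 else 0) * pd c (pd b p) (M *v x))"
    by (simp only: rows flip: sum_distrib_right)
  also have "\<dots> = lap p (M *v x)"
    by (simp add: lap_def if_distrib if_distribR cong: if_cong)
  finally show ?thesis .
qed

lemma orthogonal_matrix_norm_bound:
  fixes A :: "real ^ 'm ^ 'm::finite"
  assumes "orthogonal_matrix A"
  shows "norm A \<le> real CARD('m)"
proof -
  have "norm (A $ i) = 1" for i
  proof -
    have "row i A = A $ i" by (simp add: row_def vec_eq_iff)
    then show ?thesis using assms by (metis orthogonal_matrix_orthonormal_rows)
  qed
  moreover have "norm A \<le> (\<Sum>i\<in>UNIV. norm (A $ i))"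
    unfolding norm_vec_def[of A] by (rule L2_set_le_sum) simp
  ultimately show ?thesis by simp
qed

lemma space_haar: "haar_prob_measure G \<mu> \<Longrightarrow> space \<mu> = G"
  unfolding haar_prob_measure_def using sets_eq_imp_space_eq[of \<mu> "restrict_space borel G"]
  by (auto simp: space_restrict_space)

lemma continuous_measurable_haar:
  assumes "haar_prob_measure G \<mu>" and "continuous_on UNIV c"
  shows "c \<in> borel_measurable \<mu>"
proof -
  have "c \<in> borel_measurable (restrict_space borel G)"
    by (intro measurable_restrict_space1 borel_measurable_continuous_onI assms)
  then show ?thesis using assms(1) by (simp add: haar_prob_measure_def cong: measurable_cong_sets)
qed

text \<open>
  Orthogonal matrices form a bounded set, so a continuous function is bounded on \<open>G\<close>.
\<close>

lemma integrable_haar: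
  fixes c :: "real ^ 'm ^ 'm::finite \<Rightarrow> real"
  assumes haar: "haar_prob_measure G \<mu>" and G: "\<And>A. A \<in> G \<Longrightarrow> orthogonal_matrix A"
    and c: "continuous_on UNIV c"
  shows "integrable \<mu> c"
proof -
  interpret prob_space \<mu> using haar by (simp add: haar_prob_measure_def)
  have "bounded (c ` cball 0 (real CARD('m)))"
    by (intro compact_imp_bounded compact_continuous_image continuous_on_subset[OF c]) auto
  then obtain B where "\<forall>y\<in>c ` cball 0 (real CARD('m)). norm y \<le> B"
    unfolding bounded_iff by blast
  then have "norm (c A) \<le> B" if "A \<in> G" for A
    using orthogonal_matrix_norm_bound[OF G[OF that]] by (auto simp: image_iff)
  then show ?thesis
    using continuous_measurable_haar[OF haar c] by (intro integrable_const_bound[where B = B]) (auto simp: space_haar[OF haar])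
qed

lemma integral_haar_left:
  fixes f :: "real ^ 'm ^ 'm::finite \<Rightarrow> real"
  assumes haar: "haar_prob_measure G \<mu>" and "g \<in> G" and closed: "\<And>h. h \<in> G \<Longrightarrow> g ** h \<in> G"
    and f: "continuous_on UNIV f"
  shows "(\<integral>h. f (g ** h) \<partial>\<mu>) = (\<integral>h. f h \<partial>\<mu>)"
proof -
  have sets: "sets \<mu> = sets (restrict_space borel G)" using haar by (simp add: haar_prob_measure_def)
  have "continuous_on UNIV (\<lambda>h. g ** h)"
    unfolding matrix_matrix_mult_def by (intro continuous_intros)
  then have "(\<lambda>h. g ** h) \<in> restrict_space borel G \<rightarrow>\<^sub>M borel"
    by (intro measurable_restrict_space1 borel_measurable_continuous_onI)
  then have "(\<lambda>h. g ** h) \<in> restrict_space borel G \<rightarrow>\<^sub>M restrict_space borel G"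
    using closed by (intro measurable_restrict_space2) (auto simp: space_restrict_space)
  then have meas: "(\<lambda>h. g ** h) \<in> \<mu> \<rightarrow>\<^sub>M \<mu>"
    by (simp add: measurable_cong_sets[OF sets sets])
  have "(\<integral>h. f h \<partial>\<mu>) = (\<integral>h. f h \<partial>distr \<mu> \<mu> (\<lambda>h. g ** h))"
    using haar \<open>g \<in> G\<close> by (simp add: haar_prob_measure_def)
  also have "\<dots> = (\<integral>h. f (g ** h) \<partial>\<mu>)"
    by (rule integral_distr[OF meas continuous_measurable_haar[OF haar f]])
  finally show ?thesis by simp
qed

definition axis_stabilizer :: "'m::finite \<Rightarrow> (real ^ 'm ^ 'm) set" where
  "axis_stabilizer e = {A. rotation_matrix A \<and> A *v axis e 1 = axis e 1}"

lemma axis_stabilizer_orthogonal: "A \<in> axis_stabilizer e \<Longrightarrow> orthogonal_matrix A"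
  by (simp add: axis_stabilizer_def rotation_matrix_def)

lemma axis_stabilizer_transpose: "A \<in> axis_stabilizer e \<Longrightarrow> transpose A \<in> axis_stabilizer e"
  using orthogonal_transpose_cancel(1)[of A "axis e 1"]
  by (auto simp: axis_stabilizer_def rotation_matrix_def simp del: transpose_matrix_vector)

lemma axis_stabilizer_mult: "A \<in> axis_stabilizer e \<Longrightarrow> B \<in> axis_stabilizer e \<Longrightarrow> A ** B \<in> axis_stabilizer e"
  by (auto simp: axis_stabilizer_def rotation_matrix_def orthogonal_matrix_mul det_mul
      simp flip: matrix_vector_mul_assoc)

lemma givens_axis_stabilizer: "a \<noteq> b \<Longrightarrow> a \<noteq> e \<Longrightarrow> b \<noteq> e \<Longrightarrow> givens a b \<theta> \<in> axis_stabilizer e"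
  by (auto simp: axis_stabilizer_def rotation_givens vec_eq_iff givens_nth axis_def)

lemma zonal_cong:
  "w $ e = w' $ e \<Longrightarrow> w \<bullet> w = w' \<bullet> w' \<Longrightarrow> zonal n e j w = zonal n e j w'"
  by (induction n e j rule: zonal.induct) simp_all

lemma zonal_axis_stabilizer:
  assumes "A \<in> axis_stabilizer e"
  shows "zonal n e j (A *v w) = zonal n e j w"
proof (rule zonal_cong)
  have "(A *v w) \<bullet> (A *v axis e 1) = w \<bullet> axis e 1"
    by (rule orthogonal_matrix_inner[OF axis_stabilizer_orthogonal[OF assms]])
  then show "(A *v w) $ e = w $ e"
    using assms by (simp add: axis_stabilizer_def inner_axis)
  show "(A *v w) \<bullet> (A *v w) = w \<bullet> w"
    by (rule orthogonal_matrix_inner[OF axis_stabilizer_orthogonal[OF assms]])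
qed

definition cont_fun :: "('a::topological_space \<Rightarrow> real) set" where
  "cont_fun = {c. continuous_on UNIV c}"

lemma unital_mult_closed_cont_fun: "unital_mult_closed cont_fun"
  by (auto simp: unital_mult_closed_def cont_fun_def intro!: continuous_intros)

lemma separable_rotated:
  fixes p :: "real ^ 'm::finite \<Rightarrow> real" and R :: "real ^ 'm ^ 'm"
  assumes "poly_fun p"
  shows "separable cont_fun (\<lambda>(\<delta> :: real ^ 'm ^ 'm) w. p ((R ** transpose \<delta>) *v w))"
proof (rule separable_compose[OF unital_mult_closed_cont_fun assms])
  fix b
  have "(\<lambda>\<delta> :: real ^ 'm ^ 'm. (R ** transpose \<delta>) $ b $ a) \<in> cont_fun" for a
    unfolding cont_fun_def matrix_matrix_mult_def transpose_def by (auto intro!: continuous_intros)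
  then have "separable cont_fun (\<lambda>(\<delta> :: real ^ 'm ^ 'm) w. \<Sum>a\<in>UNIV. (R ** transpose \<delta>) $ b $ a * w $ a)"
    by (intro separable_sum unital_mult_closed_cont_fun finite separable_prod[OF _ poly_fun_nth])
  then show "separable cont_fun (\<lambda>(\<delta> :: real ^ 'm ^ 'm) w. ((R ** transpose \<delta>) *v w) $ b)"
    by (simp add: matrix_vector_mult_def)
qed

text \<open>
  The mean is a harmonic form in \<open>w\<close>.  The transpose of \<open>\<delta>\<close> makes it invariant under the
  stabilizer by the left invariance of \<open>\<mu>\<close>: \<open>\<delta>\<^sup>T \<kappa> = (\<kappa>\<^sup>T \<delta>)\<^sup>T\<close>.  Invariance under the plane
  rotations that fix the pole implies axial symmetry, so uniqueness applies, and at the pole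
  the integrand is constant.
\<close>

theorem stabilizer_mean_eq_zonal:
  fixes p :: "real ^ 'm::finite \<Rightarrow> real" and R :: "real ^ 'm ^ 'm"
  assumes card: "CARD('m) = n + 1" "2 \<le> n"
    and p: "homogeneous_harmonic j p" and R: "orthogonal_matrix R"
    and haar: "haar_prob_measure (axis_stabilizer e) \<mu>"
  shows "(\<integral>\<delta>. p ((R ** transpose \<delta>) *v w) \<partial>\<mu>) = p (R *v axis e 1) * zonal n e j w"
proof -
  interpret prob_space \<mu> using haar by (simp add: haar_prob_measure_def)
  define F where "F \<delta> w = p ((R ** transpose \<delta>) *v w)" for \<delta> :: "real ^ 'm ^ 'm" and w
  define A where "A w = (\<integral>\<delta>. F \<delta> w \<partial>\<mu>)" for w
  have poly: "poly_fun p" and hom: "\<And>s x. p (s *\<^sub>R x) = s ^ j * p x" and harm: "\<And>x. lap p x = 0"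
    using p by (auto simp: homogeneous_harmonic_def)
  have C: "integrable \<mu> c" if "c \<in> cont_fun" for c
    using that by (intro integrable_haar[OF haar axis_stabilizer_orthogonal]) (auto simp: cont_fun_def)
  have sep: "separable cont_fun F"
    unfolding F_def by (rule separable_rotated[OF poly])
  have polyA: "poly_fun A" and pdA: "pd a A = (\<lambda>w. \<integral>\<delta>. pd a (F \<delta>) w \<partial>\<mu>)" for a
    unfolding A_def by (rule separable_mean[OF C sep], assumption)+
  have pdpdA: "pd a (pd a A) = (\<lambda>w. \<integral>\<delta>. pd a (pd a (F \<delta>)) w \<partial>\<mu>)" for a
    unfolding pdA by (rule separable_mean(2)[OF C separable_pd[OF sep]])
  have lapA: "lap A w = 0" for w
  proof -
    have "lap A w = (\<integral>\<delta>. (\<Sum>a\<in>UNIV. pd a (pd a (F \<delta>)) w) \<partial>\<mu>)"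
      unfolding lap_def pdpdA
      by (intro Bochner_Integration.integral_sum[symmetric] separable_integrable[OF C separable_pd[OF separable_pd[OF sep]]])
    also have "\<dots> = (\<integral>\<delta>. 0 \<partial>\<mu>)"
    proof (intro Bochner_Integration.integral_cong refl)
      fix \<delta> assume "\<delta> \<in> space \<mu>"
      then have "orthogonal_matrix (R ** transpose \<delta>)"
        using R axis_stabilizer_orthogonal by (auto simp: space_haar[OF haar] intro!: orthogonal_matrix_mul)
      then have "lap (F \<delta>) w = 0"
        unfolding F_def by (simp only: lap_orthogonal[OF poly] harm)
      then show "(\<Sum>a\<in>UNIV. pd a (pd a (F \<delta>)) w) = 0"
        by (simp add: lap_def)
    qed
    finally show ?thesis by simp
  qed
  have homA: "A (s *\<^sub>R w) = s ^ j * A w" for s w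
    by (simp add: A_def F_def matrix_vector_mult_scaleR hom)
  have invA: "A (\<kappa> *v w) = A w" if \<kappa>: "\<kappa> \<in> axis_stabilizer e" for \<kappa> w
  proof -
    have "F \<delta> (\<kappa> *v w) = F (transpose \<kappa> ** \<delta>) w" for \<delta>
      by (simp only: F_def matrix_vector_mul_assoc matrix_transpose_mul transpose_transpose matrix_mul_assoc)
    moreover have "continuous_on UNIV (\<lambda>\<delta>. F \<delta> w)"
    proof -
      have "continuous_on UNIV (\<lambda>\<delta> :: real ^ 'm ^ 'm. (R ** transpose \<delta>) *v w)"
        unfolding matrix_matrix_mult_def matrix_vector_mult_def transpose_def
        by (simp add: continuous_intros)
      then show ?thesis
        unfolding F_def by (rule continuous_on_compose2[OF continuous_on_poly_fun[OF poly]]) auto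
    qed
    ultimately show ?thesis
      unfolding A_def using integral_haar_left[OF haar axis_stabilizer_transpose[OF \<kappa>]
        axis_stabilizer_mult[OF axis_stabilizer_transpose[OF \<kappa>]], of "\<lambda>\<delta>. F \<delta> w"] by simp
  qed
  have "axially_symmetric e A"
    unfolding axially_symmetric_def
  proof (intro allI impI)
    fix a b :: 'm and x assume ab: "a \<noteq> e" "b \<noteq> e"
    show "x $ a * pd b A x = x $ b * pd a A x"
    proof (cases "a = b")
      case False
      have "A (givens a b \<phi> *v x) = A x" for \<phi>
        by (rule invA[OF givens_axis_stabilizer[OF False ab]])
      then have "((\<lambda>\<phi>. A (givens a b \<phi> *v x)) has_real_derivative 0) (at 0)" by simp
      from DERIV_unique[OF givens_derivative[OF False polyA, of x] this]
      show ?thesis by simp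
    qed simp
  qed
  then have "A w = A (axis e 1) * zonal n e j w"
    using polyA homA lapA card by (intro axially_symmetric_harmonic_unique) (auto simp: homogeneous_harmonic_def)
  moreover have "A (axis e 1) = (\<integral>\<delta>. p (R *v axis e 1) \<partial>\<mu>)"
    unfolding A_def
  proof (intro Bochner_Integration.integral_cong refl)
    fix \<delta> assume "\<delta> \<in> space \<mu>"
    then have "transpose \<delta> *v axis e 1 = axis e 1"
      using axis_stabilizer_transpose[of \<delta> e] unfolding space_haar[OF haar] axis_stabilizer_def by blast
    then show "F \<delta> (axis e 1) = p (R *v axis e 1)"
      unfolding F_def by (simp only: matrix_vector_mul_assoc[symmetric])
  qed
  ultimately show ?thesis
    by (simp add: A_def F_def prob_space)
qed

text \<open>
  After the substitution \<open>w \<mapsto> R \<delta>\<^sup>T w\<close> the group variable occurs only in the factor \<open>p\<close>,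
  whose mean is \<open>p(R e) Z\<close>.  In the remaining integral of \<open>Z(w) q(g w)\<close> one may replace \<open>w\<close>
  by \<open>\<delta>\<^sup>T w\<close> without changing \<open>Z\<close>; averaging over \<open>\<delta>\<close> turns \<open>q(g w)\<close> into \<open>q(g e) Z\<close> by the
  same lemma.
\<close>

theorem stabilizer_mean_of_correlation:
  fixes p q :: "real ^ 'm::finite \<Rightarrow> real" and R g :: "real ^ 'm ^ 'm"
  assumes card: "CARD('m) = n + 1" "2 \<le> n"
    and p: "homogeneous_harmonic j p" and q: "homogeneous_harmonic j q"
    and R: "orthogonal_matrix R" and g: "orthogonal_matrix g"
    and haar: "haar_prob_measure (axis_stabilizer e) \<mu>"
  defines "\<Phi> \<equiv> \<lambda>\<delta>. \<integral>w. p w * q ((g ** \<delta> ** transpose R) *v w) \<partial>sphere_measure"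
  shows "integrable \<mu> \<Phi>"
    and "(\<integral>\<delta>. \<Phi> \<delta> \<partial>\<mu>) = p (R *v axis e 1) * q (g *v axis e 1) / harmonics_dim n j"
proof -
  interpret prob_space \<mu> using haar by (simp add: haar_prob_measure_def)
  let ?Z = "zonal n e j"
  have polyp: "poly_fun p" and polyq: "poly_fun q" using p q by (auto simp: homogeneous_harmonic_def)
  have C: "integrable \<mu> c" if "c \<in> cont_fun" for c
    using that by (intro integrable_haar[OF haar axis_stabilizer_orthogonal]) (auto simp: cont_fun_def)
  have subst: "(\<integral>w. f (M *v w) \<partial>sphere_measure) = (\<integral>w. f w \<partial>sphere_measure)"
    if "poly_fun f" "orthogonal_matrix M" for f and M :: "real ^ 'm ^ 'm"
    using that by (intro integral_sphere_measure_orthogonal borel_measurable_continuous_onI continuous_on_poly_fun)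
  have \<Phi>: "\<Phi> \<delta> = (\<integral>w. p ((R ** transpose \<delta>) *v w) * q (g *v w) \<partial>sphere_measure)"
    if "\<delta> \<in> space \<mu>" for \<delta> :: "real ^ 'm ^ 'm"
  proof -
    have \<delta>: "orthogonal_matrix \<delta>"
      using that axis_stabilizer_orthogonal by (auto simp: space_haar[OF haar])
    have cancel: "(g ** \<delta> ** transpose R) *v ((R ** transpose \<delta>) *v w) = g *v w" for w
      by (simp only: matrix_vector_mul_assoc[symmetric] orthogonal_transpose_cancel[OF R] orthogonal_transpose_cancel[OF \<delta>])
    have "\<Phi> \<delta> = (\<integral>w. p ((R ** transpose \<delta>) *v w) * q ((g ** \<delta> ** transpose R) *v ((R ** transpose \<delta>) *v w)) \<partial>sphere_measure)"
      unfolding \<Phi>_def using R \<delta>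
      by (intro subst[symmetric, where f = "\<lambda>w. p w * q ((g ** \<delta> ** transpose R) *v w)"])
        (auto intro!: poly_intros polyp polyq orthogonal_matrix_mul)
    then show ?thesis by (simp only: cancel)
  qed
  note fub_p = separable_fubini[OF C separable_rotated[OF polyp, of R] poly_fun_matrix[OF polyq, of g]]
  show "integrable \<mu> \<Phi>"
    using fub_p by (subst Bochner_Integration.integrable_cong[OF refl \<Phi>]) auto
  have "(\<integral>\<delta>. \<Phi> \<delta> \<partial>\<mu>) = (\<integral>\<delta>. (\<integral>w. p ((R ** transpose \<delta>) *v w) * q (g *v w) \<partial>sphere_measure) \<partial>\<mu>)"
    by (intro Bochner_Integration.integral_cong refl \<Phi>)
  also have "\<dots> = (\<integral>w. p (R *v axis e 1) * (?Z w * q (g *v w)) \<partial>sphere_measure)"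
    using fub_p by (simp add: stabilizer_mean_eq_zonal[OF card p R haar] mult.assoc)
  also have "\<dots> = p (R *v axis e 1) * (\<integral>w. ?Z w * q (g *v w) \<partial>sphere_measure)"
    by simp
  also have "(\<integral>w. ?Z w * q (g *v w) \<partial>sphere_measure) = q (g *v axis e 1) / harmonics_dim n j"
  proof -
    have Z: "(\<integral>w. ?Z w * q (g *v w) \<partial>sphere_measure)
        = (\<integral>w. q ((g ** transpose \<delta>) *v w) * ?Z w \<partial>sphere_measure)" if "\<delta> \<in> space \<mu>" for \<delta>
    proof -
      have \<delta>: "transpose \<delta> \<in> axis_stabilizer e"
        using that axis_stabilizer_transpose by (auto simp: space_haar[OF haar])
      have "(\<integral>w. ?Z w * q (g *v w) \<partial>sphere_measure)
          = (\<integral>w. ?Z (transpose \<delta> *v w) * q (g *v (transpose \<delta> *v w)) \<partial>sphere_measure)"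
        using axis_stabilizer_orthogonal[OF \<delta>]
        by (intro subst[symmetric, where f = "\<lambda>w. ?Z w * q (g *v w)"]) (auto intro!: poly_intros polyq)
      then show ?thesis
        by (simp only: zonal_axis_stabilizer[OF \<delta>] matrix_vector_mul_assoc mult.commute)
    qed
    have "(\<integral>w. ?Z w * q (g *v w) \<partial>sphere_measure)
        = (\<integral>\<delta>. (\<integral>w. ?Z w * q (g *v w) \<partial>sphere_measure) \<partial>\<mu>)"
      by (simp add: prob_space)
    also have "\<dots> = (\<integral>\<delta>. (\<integral>w. q ((g ** transpose \<delta>) *v w) * ?Z w \<partial>sphere_measure) \<partial>\<mu>)"
      by (intro Bochner_Integration.integral_cong refl Z)
    also have "\<dots> = (\<integral>w. q (g *v axis e 1) * (?Z w * ?Z w) \<partial>sphere_measure)"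
      using separable_fubini[OF C separable_rotated[OF polyq, of g] poly_fun_zonal]
      by (simp add: stabilizer_mean_eq_zonal[OF card q g haar] mult.assoc)
    also have "\<dots> = q (g *v axis e 1) / harmonics_dim n j"
      by (simp add: zonal_square_integral[OF card])
    finally show ?thesis .
  qed
  finally show "(\<integral>\<delta>. \<Phi> \<delta> \<partial>\<mu>) = p (R *v axis e 1) * q (g *v axis e 1) / harmonics_dim n j"
    by simp
qed

section \<open>Jacobi polynomials as harmonic forms\<close>

definition partial_normsq :: "'m set \<Rightarrow> real ^ 'm::finite \<Rightarrow> real" where
  "partial_normsq S w = (\<Sum>a\<in>S. w $ a * w $ a)"

lemma poly_fun_partial_normsq [poly_intros]: "poly_fun (partial_normsq S)"
  unfolding partial_normsq_def[abs_def] by (intro poly_intros)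

lemma pd_partial_normsq:
  fixes S :: "'m::finite set"
  shows "pd a (partial_normsq S) = (\<lambda>w. if a \<in> S then 2 * w $ a else 0)"
proof
  fix w :: "real ^ 'm"
  have "pd a (partial_normsq S) w = (\<Sum>b\<in>S. pd a (\<lambda>w. w $ b * w $ b) w)"
    unfolding partial_normsq_def[abs_def] by (simp only: pd_sum poly_intros)
  also have "\<dots> = (\<Sum>b\<in>S. if a = b then 2 * w $ a else 0)"
    by (intro sum.cong refl) (simp add: pd_mult poly_intros)
  finally have "pd a (partial_normsq S) w = (\<Sum>b\<in>S. if a = b then 2 * w $ a else 0)" .
  then show "pd a (partial_normsq S) w = (if a \<in> S then 2 * w $ a else 0)" by simp
qed

lemma pd_partial_normsq_power:
  "pd a (\<lambda>w. partial_normsq S w ^ s) =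
    (\<lambda>w. if a \<in> S then 2 * real s * (partial_normsq S w ^ (s - 1) * w $ a) else 0)"
  by (auto simp: pd_power poly_intros pd_partial_normsq fun_eq_iff)

lemma lap_partial_normsq_power:
  "lap (\<lambda>w. partial_normsq S w ^ s) x =
    2 * real s * (2 * (real s - 1) + real (card S)) * partial_normsq S x ^ (s - 1)"
proof (cases s)
  case 0
  then show ?thesis by (simp add: lap_def)
next
  case (Suc i)
  let ?u = "partial_normsq S"
  have first: "pd a (\<lambda>w. ?u w ^ s) = (\<lambda>w. if a \<in> S then 2 * real s * (?u w ^ i * w $ a) else 0)" for a
    unfolding pd_partial_normsq_power using Suc by (auto simp: fun_eq_iff)
  have "pd a (pd a (\<lambda>w. ?u w ^ s)) x =
      (if a \<in> S then 2 * real s * (2 * real i * ?u x ^ (i - 1) * (x $ a * x $ a) + ?u x ^ i) else 0)" for a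
    unfolding first by (cases "a \<in> S") (simp_all add: pd_partial_normsq_power pd_cmult pd_mult poly_intros)
  then have "lap (\<lambda>w. ?u w ^ s) x =
      (\<Sum>a\<in>S. 2 * real s * (2 * real i * ?u x ^ (i - 1) * (x $ a * x $ a) + ?u x ^ i))"
    by (simp add: lap_def sum.If_cases)
  also have "\<dots> = 2 * real s * (2 * (real i * (?u x ^ (i - 1) * ?u x)) + real (card S) * ?u x ^ i)"
    by (simp add: sum_distrib_left[symmetric] sum.distrib partial_normsq_def mult.assoc)
  also have "real i * (?u x ^ (i - 1) * ?u x) = real i * ?u x ^ i"
    by (cases i) simp_all
  finally show ?thesis
    by (simp add: Suc algebra_simps)
qed

lemma lap_partial_normsq_product:
  "lap (\<lambda>w. partial_normsq S w ^ s * partial_normsq (- S) w ^ t) x =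
    2 * real s * (2 * (real s - 1) + real (card S)) * (partial_normsq S x ^ (s - 1) * partial_normsq (- S) x ^ t) +
    2 * real t * (2 * (real t - 1) + real (card (- S))) * (partial_normsq S x ^ s * partial_normsq (- S) x ^ (t - 1))"
proof -
  have "(\<Sum>a\<in>UNIV. pd a (\<lambda>w. partial_normsq S w ^ s) x * pd a (\<lambda>w. partial_normsq (- S) w ^ t) x) = 0"
    by (intro sum.neutral) (simp add: pd_partial_normsq_power)
  then show ?thesis
    by (subst lap_mult) (simp_all add: poly_intros lap_partial_normsq_power mult_ac)
qed

text \<open>
  The homogenized Jacobi polynomial.  With \<open>u\<close> and \<open>v\<close> the squared norms of the components of
  \<open>w\<close> along \<open>S\<close> and \<open>- S\<close>, one has \<open>(t - 1) / 2 = - u\<close> and \<open>(t + 1) / 2 = v\<close> for \<open>t = 2 v -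
  1\<close> when \<open>u + v = 1\<close>.  The sum in \<open>jacobi_P\<close> then becomes a form of degree \<open>2 m\<close>.
\<close>

definition jacobi_form :: "real \<Rightarrow> real \<Rightarrow> nat \<Rightarrow> 'm::finite set \<Rightarrow> real ^ 'm \<Rightarrow> real" where
  "jacobi_form \<rho> \<sigma> m S w = (\<Sum>s\<le>m.
     ((-1) ^ s * ((real m + \<rho>) gchoose (m - s)) * ((real m + \<sigma>) gchoose s)) *
     (partial_normsq S w ^ s * partial_normsq (- S) w ^ (m - s)))"

lemma partial_normsq_compl: "partial_normsq S w + partial_normsq (- S) w = w \<bullet> w"
  unfolding partial_normsq_def inner_vec_def
  by (subst sum.union_disjoint[symmetric]) (auto intro: sum.cong)

lemma jacobi_form_sphere:
  assumes "w \<bullet> w = 1"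
  shows "jacobi_form \<rho> \<sigma> m S w = jacobi_P \<rho> \<sigma> m (2 * partial_normsq (- S) w - 1)"
proof -
  have "(2 * partial_normsq (- S) w - 1 - 1) / 2 = - partial_normsq S w"
    "(2 * partial_normsq (- S) w - 1 + 1) / 2 = partial_normsq (- S) w"
    using partial_normsq_compl[of S w] assms by simp_all
  then show ?thesis
    unfolding jacobi_form_def jacobi_P_def
    by (simp only: power_minus[of "partial_normsq S w"]) (simp add: mult_ac)
qed

lemma gbinomial_step: "real (Suc k) * (a gchoose Suc k) = (a - real k) * (a gchoose k)"
  using gbinomial_mult_1[of a k] by (simp add: algebra_simps)

text \<open>
  The Laplacian of \<open>u\<^sup>s v\<^sup>m\<^sup>-\<^sup>s\<close> has one term that lowers the power of \<open>u\<close> and one that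
  lowers that of \<open>v\<close>.  The condition on the cardinalities turns their factors into \<open>4 s (s +
  \<rho>)\<close> and \<open>4 (m - s) (m - s + \<sigma>)\<close>, and for these the contributions of consecutive
  coefficients cancel.
\<close>

lemma homogeneous_harmonic_jacobi_form:
  fixes S :: "'m::finite set"
  assumes S: "real (card S) = 2 * \<rho> + 2" "real (card (- S)) = 2 * \<sigma> + 2"
  shows "homogeneous_harmonic (2 * m) (jacobi_form \<rho> \<sigma> m S)"
proof -
  define c where "c s = (-1) ^ s * ((real m + \<rho>) gchoose (m - s)) * ((real m + \<sigma>) gchoose s)" for s
  have form: "jacobi_form \<rho> \<sigma> m S =
      (\<lambda>w. \<Sum>s\<le>m. c s * (partial_normsq S w ^ s * partial_normsq (- S) w ^ (m - s)))"
    by (simp add: jacobi_form_def c_def fun_eq_iff)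
  have "poly_fun (jacobi_form \<rho> \<sigma> m S)"
    unfolding form by (intro real_polynomial_function_sum finite_atMost poly_intros)
  moreover have "jacobi_form \<rho> \<sigma> m S (t *\<^sub>R w) = t ^ (2 * m) * jacobi_form \<rho> \<sigma> m S w" for t w
  proof -
    have scale: "partial_normsq T (t *\<^sub>R w) = t\<^sup>2 * partial_normsq T w" for T
      by (simp add: partial_normsq_def sum_distrib_left power2_eq_square mult_ac)
    have "(t\<^sup>2 * u) ^ s * (t\<^sup>2 * v) ^ (m - s) = t ^ (2 * m) * (u ^ s * v ^ (m - s))" if "s \<le> m" for s u v
    proof -
      have "t ^ (2 * m) = (t\<^sup>2) ^ s * (t\<^sup>2) ^ (m - s)"
        using that by (simp add: diff_mult_distrib2 flip: power_add power_mult)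
      then show ?thesis by (simp add: power_mult_distrib)
    qed
    then show ?thesis
      unfolding form scale sum_distrib_left by (intro sum.cong refl) simp
  qed
  moreover have "lap (jacobi_form \<rho> \<sigma> m S) x = 0" for x
  proof (cases m)
    case 0
    then have "jacobi_form \<rho> \<sigma> m S = (\<lambda>w. c 0)" unfolding form by simp
    then show ?thesis by (simp add: lap_def)
  next
    case (Suc i)
    let ?u = "partial_normsq S x" and ?v = "partial_normsq (- S) x"
    have cancel: "c (Suc s) * (4 * real (Suc s) * (real (Suc s) + \<rho>)) + c s * (4 * real (m - s) * (real (m - s) + \<sigma>)) = 0"
      if "s < m" for s
    proof -
      define A B where "A = (real m + \<rho>) gchoose (m - Suc s)" and "B = (real m + \<sigma>) gchoose s"
      have ms: "m - s = Suc (m - Suc s)" using that by simp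
      have 1: "real (m - s) * ((real m + \<rho>) gchoose (m - s)) = (\<rho> + real (Suc s)) * A"
        using gbinomial_step[of "m - Suc s" "real m + \<rho>"] that unfolding ms A_def
        by (simp add: of_nat_diff algebra_simps)
      have 2: "real (Suc s) * ((real m + \<sigma>) gchoose (Suc s)) = (real (m - s) + \<sigma>) * B"
        using gbinomial_step[of s "real m + \<sigma>"] that unfolding B_def
        by (simp add: of_nat_diff algebra_simps)
      have "c (Suc s) * (4 * real (Suc s) * (real (Suc s) + \<rho>))
          = - 4 * (-1) ^ s * A * (real (Suc s) + \<rho>) * (real (Suc s) * ((real m + \<sigma>) gchoose (Suc s)))"
        by (simp add: c_def A_def)
      also have "\<dots> = - 4 * (-1) ^ s * ((\<rho> + real (Suc s)) * A) * ((real (m - s) + \<sigma>) * B)"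
        unfolding 2 by (simp add: mult_ac add_ac)
      also have "\<dots> = - (c s * (4 * real (m - s) * (real (m - s) + \<sigma>)))"
        unfolding 1[symmetric] by (simp add: c_def B_def)
      finally show ?thesis by simp
    qed
    have "lap (jacobi_form \<rho> \<sigma> m S) x
        = (\<Sum>s\<le>m. c s * lap (\<lambda>w. partial_normsq S w ^ s * partial_normsq (- S) w ^ (m - s)) x)"
      unfolding form lap_def
      by (simp add: pd_sum pd_cmult poly_intros sum_distrib_left) (rule sum.swap)
    also have "\<dots> = (\<Sum>s\<le>m. c s * (4 * real s * (real s + \<rho>)) * (?u ^ (s - 1) * ?v ^ (m - s)))
        + (\<Sum>s\<le>m. c s * (4 * real (m - s) * (real (m - s) + \<sigma>)) * (?u ^ s * ?v ^ (m - s - 1)))"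
      unfolding sum.distrib[symmetric] lap_partial_normsq_product S
      by (intro sum.cong refl) (simp add: algebra_simps)
    also have "(\<Sum>s\<le>m. c s * (4 * real s * (real s + \<rho>)) * (?u ^ (s - 1) * ?v ^ (m - s)))
        = (\<Sum>s\<le>i. c (Suc s) * (4 * real (Suc s) * (real (Suc s) + \<rho>)) * (?u ^ s * ?v ^ (i - s)))"
      unfolding Suc by (subst sum.atMost_Suc_shift) simp
    also have "(\<Sum>s\<le>m. c s * (4 * real (m - s) * (real (m - s) + \<sigma>)) * (?u ^ s * ?v ^ (m - s - 1)))
        = (\<Sum>s\<le>i. c s * (4 * real (m - s) * (real (m - s) + \<sigma>)) * (?u ^ s * ?v ^ (m - s - 1)))"
      unfolding Suc
      by (simp only: sum.atMost_Suc diff_self_eq_0 of_nat_0 mult_zero_left mult_zero_right add_0_right)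
    also have "\<dots> = (\<Sum>s\<le>i. c s * (4 * real (m - s) * (real (m - s) + \<sigma>)) * (?u ^ s * ?v ^ (i - s)))"
      by (simp add: Suc)
    also have "(\<Sum>s\<le>i. c (Suc s) * (4 * real (Suc s) * (real (Suc s) + \<rho>)) * (?u ^ s * ?v ^ (i - s))) + \<dots>
        = (\<Sum>s\<le>i. (c (Suc s) * (4 * real (Suc s) * (real (Suc s) + \<rho>)) + c s * (4 * real (m - s) * (real (m - s) + \<sigma>)))
            * (?u ^ s * ?v ^ (i - s)))"
      by (simp add: sum.distrib distrib_right)
    also have "\<dots> = 0"
      using cancel Suc by (intro sum.neutral) auto
    finally show ?thesis .
  qed
  ultimately show ?thesis by (simp add: homogeneous_harmonic_def)
qed

lemma homogeneous_harmonic_divide: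
  "homogeneous_harmonic j F \<Longrightarrow> homogeneous_harmonic j (\<lambda>w. F w / d)"
  using lap_cmult[of F "1 / d"] by (auto simp: homogeneous_harmonic_def poly_intros)

text \<open>
  The real and imaginary parts of a complex harmonic polynomial can thus be treated
  separately.
\<close>

lemma laplacian_component:
  fixes p :: "real ^ 'm::finite \<Rightarrow> complex"
  assumes p: "polynomial_function p"
  shows "lap (\<lambda>x. Re (p x)) x = Re (laplacian p x)" and "lap (\<lambda>x. Im (p x)) x = Im (laplacian p x)"
proof -
  let ?r = "\<lambda>x. Re (p x)" and ?i = "\<lambda>x. Im (p x)"
  have r: "poly_fun ?r" and i: "poly_fun ?i"
    using p bounded_linear_Re bounded_linear_Im by (auto simp: polynomial_function_def o_def)
  have vd: "vector_derivative (\<lambda>t. Complex (F (x + t *\<^sub>R axis a 1)) (G (x + t *\<^sub>R axis a 1))) (at s)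
      = Complex (pd a F (x + s *\<^sub>R axis a 1)) (pd a G (x + s *\<^sub>R axis a 1))"
    if "poly_fun F" "poly_fun G" for F G :: "real ^ 'm \<Rightarrow> real" and a x s
  proof (rule vector_derivative_at)
    have "((\<lambda>t. of_real (F (x + t *\<^sub>R axis a 1)) + \<i> * of_real (G (x + t *\<^sub>R axis a 1))) has_vector_derivative
       of_real (pd a F (x + s *\<^sub>R axis a 1)) + \<i> * of_real (pd a G (x + s *\<^sub>R axis a 1))) (at s)"
      using has_pd[OF that(1), of x a s] has_pd[OF that(2), of x a s]
      by (intro has_vector_derivative_add has_vector_derivative_mult_right has_vector_derivative_of_real)
        (simp_all add: has_real_derivative_iff_has_vector_derivative)
    then show "((\<lambda>t. Complex (F (x + t *\<^sub>R axis a 1)) (G (x + t *\<^sub>R axis a 1))) has_vector_derivative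
       Complex (pd a F (x + s *\<^sub>R axis a 1)) (pd a G (x + s *\<^sub>R axis a 1))) (at s)"
      by (simp add: Complex_eq)
  qed
  have "vector_derivative (\<lambda>s. vector_derivative (\<lambda>t. p (x + t *\<^sub>R axis a 1)) (at s)) (at 0)
      = Complex (pd a (pd a ?r) x) (pd a (pd a ?i) x)" for a
  proof -
    have "(\<lambda>s. vector_derivative (\<lambda>t. p (x + t *\<^sub>R axis a 1)) (at s))
      = (\<lambda>s. Complex (pd a ?r (x + s *\<^sub>R axis a 1)) (pd a ?i (x + s *\<^sub>R axis a 1)))"
      using vd[OF r i] by simp
    then show ?thesis
      using vd[OF poly_fun_pd[OF r] poly_fun_pd[OF i], where s = 0] by simp
  qed
  then have "laplacian p x = (\<Sum>a\<in>UNIV. Complex (pd a (pd a ?r) x) (pd a (pd a ?i) x))"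
    unfolding laplacian_def Basis_vec_def
    by (subst sum.reindex_bij_witness[of _ "\<lambda>b. axis b (1 :: real)" "\<lambda>x. SOME a. x = axis a 1"])
      (auto simp: axis_eq_axis)
  then show "lap ?r x = Re (laplacian p x)" and "lap ?i x = Im (laplacian p x)"
    by (simp_all add: lap_def)
qed

lemma spherical_harmonic_decompose:
  assumes "spherical_harmonic j Y"
  obtains p q where "homogeneous_harmonic j p" "homogeneous_harmonic j q"
    "\<And>x. x \<in> sphere 0 1 \<Longrightarrow> Y x = of_real (p x) + \<i> * of_real (q x)"
proof -
  obtain f where f: "polynomial_function f" "\<And>a x. f (a *\<^sub>R x) = a ^ j *\<^sub>R f x"
    "\<And>x. laplacian f x = 0" "\<And>x. x \<in> sphere 0 1 \<Longrightarrow> Y x = f x"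
    using assms unfolding spherical_harmonic_def by blast
  have "homogeneous_harmonic j (\<lambda>x. Re (f x))" "homogeneous_harmonic j (\<lambda>x. Im (f x))"
    using f(1) bounded_linear_Re bounded_linear_Im
    by (auto simp: homogeneous_harmonic_def f laplacian_component[OF f(1)] polynomial_function_def o_def)
  moreover have "Y x = of_real (Re (f x)) + \<i> * of_real (Im (f x))" if "x \<in> sphere 0 1" for x
    using f(4)[OF that] by (simp add: complex_eq flip: Complex_eq)
  ultimately show ?thesis by (rule that)
qed

lemma matrix_inv_orthogonal:
  fixes M :: "real ^ 'm ^ 'm::finite"
  assumes "orthogonal_matrix M"
  shows "matrix_inv M = transpose M"
proof -
  have ex: "\<exists>N. M ** N = mat 1 \<and> N ** M = mat 1"
    using assms by (auto simp: orthogonal_matrix_def)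
  have "M ** matrix_inv M = mat 1"
    using someI_ex[OF ex] by (simp add: matrix_inv_def)
  then have "transpose M ** (M ** matrix_inv M) = transpose M" by simp
  then show ?thesis
    using assms by (simp only: matrix_mul_assoc orthogonal_matrix_def matrix_mul_lid)
qed

lemma (in prob_space) integral_pair_snd:
  fixes f :: "'b \<Rightarrow> complex"
  assumes N: "prob_space N" and f: "f \<in> borel_measurable N"
  shows "(\<integral>(x, y). f y \<partial>(M \<Otimes>\<^sub>M N)) = (\<integral>y. f y \<partial>N)"
proof -
  interpret N: prob_space N by fact
  have "distr (M \<Otimes>\<^sub>M N) N snd = N"
  proof (intro measure_eqI)
    fix A assume A: "A \<in> sets (distr (M \<Otimes>\<^sub>M N) N snd)"
    then have "emeasure (distr (M \<Otimes>\<^sub>M N) N snd) A = emeasure (M \<Otimes>\<^sub>M N) (space M \<times> A)"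
      by (auto simp: emeasure_distr space_pair_measure dest: sets.sets_into_space intro!: arg_cong2[where f = emeasure])
    with A show "emeasure (distr (M \<Otimes>\<^sub>M N) N snd) A = emeasure N A"
      by (simp add: N.emeasure_pair_measure_Times emeasure_space_1)
  qed simp
  then have "(\<integral>y. f y \<partial>N) = (\<integral>y. f y \<partial>distr (M \<Otimes>\<^sub>M N) N snd)" by simp
  also have "\<dots> = (\<integral>z. f (snd z) \<partial>(M \<Otimes>\<^sub>M N))"
    by (intro integral_distr f) simp
  finally show ?thesis by (simp add: case_prod_unfold)
qed

section \<open>The dual bispherical mean of a Stiefel harmonic\<close>

lemma orthogonal_fixes_nth:
  fixes A :: "real ^ 'm ^ 'm::finite"
  assumes "orthogonal_matrix A" "A *v axis a 1 = axis a 1"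
  shows "(A *v z) $ a = z $ a"
proof -
  have "(A *v z) \<bullet> (A *v axis a 1) = z \<bullet> axis a 1"
    by (rule orthogonal_matrix_inner[OF assms(1)])
  then show ?thesis using assms(2) by (simp add: inner_axis)
qed

lemma group_K'_orthogonal: "\<gamma> \<in> group_K' n k r \<Longrightarrow> orthogonal_matrix \<gamma>"
  by (auto simp: group_K'_def rotation_matrix_def orthogonal_matrix_mul)

text \<open>
  A factor in \<open>SO(n-k)\<close> fixes the coordinates in \<open>S\<close> and the full norm, hence the norm of
  the other component; a factor in \<open>SO(k+1)\<close> fixes each coordinate outside \<open>S\<close>.
\<close>

lemma group_K'_partial_normsq:
  fixes r :: "nat \<Rightarrow> 'm::finite"
  assumes \<gamma>: "\<gamma> \<in> group_K' n k r" and r: "bij_betw r {1..n + 1} UNIV"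
  defines "S \<equiv> r ` {1..k + 1}"
  shows "partial_normsq (- S) (\<gamma> *v z) = partial_normsq (- S) z"
proof -
  obtain A B where AB: "\<gamma> = A ** B" "orthogonal_matrix A" "orthogonal_matrix B"
    and A: "\<And>i. i \<in> {1..k + 1} \<Longrightarrow> A *v axis (r i) 1 = axis (r i) 1"
    and B: "\<And>i. i \<in> {k + 2..n + 1} \<Longrightarrow> B *v axis (r i) 1 = axis (r i) 1"
    using \<gamma> unfolding group_K'_def unit_vec_def rotation_matrix_def by blast
  have "partial_normsq S (A *v w) = partial_normsq S w" for w
    unfolding partial_normsq_def S_def
    by (intro sum.cong refl) (auto simp: orthogonal_fixes_nth[OF AB(2) A])
  moreover have "(A *v w) \<bullet> (A *v w) = w \<bullet> w" for w
    by (rule orthogonal_matrix_inner[OF AB(2)])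
  ultimately have "partial_normsq (- S) (A *v w) = partial_normsq (- S) w" for w
    using partial_normsq_compl[of S "A *v w"] partial_normsq_compl[of S w] by simp
  moreover have "partial_normsq (- S) (B *v z) = partial_normsq (- S) z"
    unfolding partial_normsq_def
  proof (intro sum.cong refl)
    fix a assume "a \<in> - S"
    moreover obtain i where "a = r i" "i \<in> {1..n + 1}"
      using r unfolding bij_betw_def by blast
    ultimately have "a = r i" "i \<in> {k + 2..n + 1}"
      by (auto simp: S_def not_le)
    then show "(B *v z) $ a * (B *v z) $ a = z $ a * z $ a"
      using orthogonal_fixes_nth[OF AB(3) B] by simp
  qed
  ultimately show ?thesis by (simp add: AB(1) flip: matrix_vector_mul_assoc)
qed

text \<open>
  The columns of \<open>v0\<close> are distinct basis vectors, indexed by \<open>d\<close>, that span the coordinate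
  subspace on which \<open>SO(n-k)\<close> acts.  So \<open>|z\<^sup>Tv\<^sub>0|\<^sup>2\<close> is a partial sum of squares of
  coordinates of \<open>z\<close>.
\<close>

lemma v0_columns:
  fixes r :: "nat \<Rightarrow> 'm::finite" and c :: "nat \<Rightarrow> 'l::finite"
  assumes r: "bij_betw r {1..n + 1} UNIV" and c: "bij_betw c {1..n - k} UNIV" and "k \<le> n"
  obtains d where "inj d" and "range d = - (r ` {1..k + 1})"
    and "v0 n k r c = (\<chi> a b. if a = d b then 1 else 0)"
proof -
  define d where "d b = r (k + 1 + inv_into {1..n - k} c b)" for b
  have inj: "inj_on c {1..n - k}" and surj: "c ` {1..n - k} = UNIV"
    and injr: "inj_on r {1..n + 1}" and surjr: "r ` {1..n + 1} = UNIV"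
    using r c by (auto simp: bij_betw_def)
  have inv: "inv_into {1..n - k} c b \<in> {1..n - k}" "c (inv_into {1..n - k} c b) = b" for b
    using surj by (simp_all only: inv_into_into f_inv_into_f UNIV_I)
  have dc: "d (c i) = r (k + 1 + i)" if "i \<in> {1..n - k}" for i
    using inv_into_f_f[OF inj that] by (simp add: d_def)
  have range: "range d = r ` {k + 2..n + 1}"
  proof -
    have "range d = d ` c ` {1..n - k}" by (simp only: surj)
    also have "\<dots> = r ` (\<lambda>i. k + 1 + i) ` {1..n - k}"
      unfolding image_image by (intro image_cong refl dc)
    also have "(\<lambda>i. k + 1 + i) ` {1..n - k} = {1 + (k + 1)..n - k + (k + 1)}"
      by (rule image_add_atLeastAtMost)
    also have "\<dots> = {k + 2..n + 1}" using \<open>k \<le> n\<close> by simp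
    finally show ?thesis .
  qed
  have split: "{1..n + 1} = {1..k + 1} \<union> {k + 2..n + 1}" "{1..k + 1} \<inter> {k + 2..n + 1} = {}"
    using \<open>k \<le> n\<close> by auto
  have "inj d"
  proof
    fix b b' assume "d b = d b'"
    then have "k + 1 + inv_into {1..n - k} c b = k + 1 + inv_into {1..n - k} c b'"
      using inv(1)[of b] inv(1)[of b'] unfolding d_def
      by (intro inj_onD[OF injr]) auto
    then show "b = b'" using inv(2) by (metis add_left_cancel)
  qed
  moreover have "range d = - (r ` {1..k + 1})"
  proof -
    have "r ` {1..k + 1} \<inter> r ` {k + 2..n + 1} = {}"
      using injr split by (metis Un_upper1 Un_upper2 image_empty inj_on_image_Int)
    moreover have "r ` {1..k + 1} \<union> r ` {k + 2..n + 1} = UNIV"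
      using surjr split by (metis image_Un)
    ultimately show ?thesis unfolding range by blast
  qed
  moreover have "(\<exists>i\<in>{1..n - k}. a = r (k + 1 + i) \<and> b = c i) \<longleftrightarrow> a = d b" for a b
    using dc inv by metis
  then have "v0 n k r c = (\<chi> a b. if a = d b then 1 else 0)"
    by (simp add: v0_def)
  ultimately show ?thesis by (rule that)
qed

lemma coordinate_columns_norm:
  fixes d :: "'l::finite \<Rightarrow> 'm::finite" and z :: "real ^ 'm"
  assumes "inj d"
  shows "(norm (z v* (\<chi> a b. if a = d b then 1 else 0)))\<^sup>2 = partial_normsq (range d) z"
proof -
  have "(z v* (\<chi> a b. if a = d b then 1 else 0)) $ b = z $ d b" for b
    by (simp add: vector_matrix_mult_def if_distrib if_distribR cong: if_cong)
  then have "(norm (z v* (\<chi> a b. if a = d b then 1 else 0)))\<^sup>2 = (\<Sum>b\<in>UNIV. z $ d b * z $ d b)"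
    by (simp add: power2_norm_eq_inner inner_vec_def)
  also have "\<dots> = partial_normsq (range d) z"
    unfolding partial_normsq_def by (simp add: sum.reindex[OF assms])
  finally show ?thesis .
qed

lemma coordinate_columns_stiefel:
  fixes d :: "'l::finite \<Rightarrow> 'm::finite"
  assumes "inj d" and "orthogonal_matrix N"
  shows "N ** (\<chi> a b. if a = d b then 1 else 0) \<in> stiefel_manifold"
proof -
  let ?v = "(\<chi> a b. if a = d b then 1 else 0) :: real ^ 'l ^ 'm"
  have "(transpose ?v ** ?v) $ b $ b' = mat 1 $ b $ b'" for b b'
  proof -
    have "(transpose ?v ** ?v) $ b $ b' = (\<Sum>a\<in>UNIV. ?v $ a $ b * ?v $ a $ b')"
      by (simp add: matrix_matrix_mult_def transpose_def)
    also have "\<dots> = (\<Sum>a\<in>UNIV. if a = d b then (if b = b' then 1 else 0) else 0)"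
      using inj_eq[OF assms(1)] by (intro sum.cong refl) auto
    finally show ?thesis by (simp add: mat_def)
  qed
  then have "transpose ?v ** ?v = mat 1" unfolding vec_eq_iff by blast
  moreover have "transpose (N ** ?v) ** (N ** ?v) = transpose ?v ** ((transpose N ** N) ** ?v)"
    by (simp only: matrix_transpose_mul matrix_mul_assoc)
  ultimately show ?thesis
    using assms(2) by (simp add: stiefel_manifold_def orthogonal_matrix_def)
qed

theorem theorem3p11:
  fixes n k j :: nat and \<tau> \<rho> \<sigma> :: real
    and r :: "nat \<Rightarrow> 'm::finite" and c :: "nat \<Rightarrow> 'l::finite"
    and \<mu>' \<mu> :: "(real ^ 'm ^ 'm) measure"
    and rot :: "real ^ 'm \<Rightarrow> real ^ 'm ^ 'm"
    and Y :: "real ^ 'm \<Rightarrow> complex"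
    and x :: "real ^ 'm"
  assumes "2 \<le> n" and "1 \<le> k" and "k \<le> n - 1"
    and "bij_betw r {1..n + 1} UNIV"
    and "bij_betw c {1..n - k} UNIV"
    and "0 \<le> \<tau>" and "\<tau> \<le> 1"
    and "haar_prob_measure (group_K' n k r) \<mu>'"
    and "haar_prob_measure (stabilizer_K n r) \<mu>"
    and "\<And>y. y \<in> sphere 0 1 \<Longrightarrow> rotation_matrix (rot y) \<and> rot y *v unit_vec r (n + 1) = y"
    and "even j" and "spherical_harmonic j Y"
    and "\<rho> = (real k - 1) / 2" and "\<sigma> = (real n - real k) / 2 - 1"
    and "x \<in> sphere 0 1"
  shows "dual_bispherical_mean n k r c \<mu>' \<mu> rot \<tau>
           (stiefel_harmonic n k j Y :: real ^ 'l ^ 'm \<Rightarrow> complex) x =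
         of_real (varkappa n k j / sqrt (harmonics_dim n j) *
           jacobi_R \<rho> \<sigma> (j div 2) (2 * \<tau>\<^sup>2 - 1)) * Y x"
proof -
  note n = assms(1) and r = assms(4) and c = assms(5)
  have kn: "k \<le> n" "k + 1 \<noteq> n + 1" using assms(1-3) by auto
  \<comment> \<open>\<open>S\<close> indexes the subspace of \<open>SO(k+1)\<close> and \<open>q\<close> is the harmonic form that agrees with
    the Jacobi kernel on the sphere.  The functions \<open>p1\<close> and \<open>p2\<close> below are the real and
    imaginary parts of \<open>Y\<close>.\<close>
  define m where "m = j div 2"
  have j: "j = 2 * m" using \<open>even j\<close> by (simp add: m_def)
  define e where "e = r (n + 1)"
  define g where "g = plane_rotation n k r (arccos \<tau>)"
  define S where "S = r ` {1..k + 1}"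
  define R where "R = rot x"
  define \<kappa> where "\<kappa> = varkappa n k j * sqrt (harmonics_dim n j)"
  have injr: "inj_on r {1..n + 1}" and "r ` {1..n + 1} = UNIV"
    using r by (auto simp: bij_betw_def)
  then have card: "CARD('m) = n + 1" by (metis card_atLeastAtMost card_image diff_Suc_1 Suc_eq_plus1)
  have cardS: "card S = k + 1"
    using card_image[OF inj_on_subset[OF injr, of "{1..k + 1}"]] kn by (simp add: S_def)
  then have "card (- S) = n - k"
    using card kn by (simp add: Compl_eq_Diff_UNIV card_Diff_subset)
  with cardS have S: "real (card S) = 2 * \<rho> + 2" "real (card (- S)) = 2 * \<sigma> + 2"
    using kn assms(13,14) by (simp_all add: of_nat_diff)
  define q where "q w = jacobi_form \<rho> \<sigma> m S w / jacobi_P \<rho> \<sigma> m 1" for w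
  have q: "homogeneous_harmonic j q"
    unfolding q_def j by (intro homogeneous_harmonic_divide homogeneous_harmonic_jacobi_form S)
  have q_sphere: "q w = jacobi_R \<rho> \<sigma> m (2 * partial_normsq (- S) w - 1)" if "w \<bullet> w = 1" for w
    using that by (simp add: q_def jacobi_R_def jacobi_form_sphere)
  have ne: "r (k + 1) \<noteq> e"
    using inj_onD[OF injr, of "k + 1" "n + 1"] kn by (auto simp: e_def)
  have g_givens: "g = givens (r (k + 1)) e (arccos \<tau>)"
    unfolding g_def plane_rotation_def givens_def e_def ..
  have g: "orthogonal_matrix g"
    unfolding g_givens by (rule orthogonal_givens[OF ne])
  have R: "orthogonal_matrix R" "R *v axis e 1 = x"
    using assms(10)[OF assms(15)] by (auto simp: R_def e_def unit_vec_def rotation_matrix_def)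
  have haar: "haar_prob_measure (axis_stabilizer e) \<mu>"
    using assms(9) by (simp add: stabilizer_K_def axis_stabilizer_def unit_vec_def e_def)
  obtain d :: "'l \<Rightarrow> 'm" where d: "inj d" "range d = - S"
    "v0 n k r c = (\<chi> a b. if a = d b then 1 else 0)"
    using v0_columns[OF r c kn(1)] unfolding S_def by metis
  obtain p1 p2 where p: "homogeneous_harmonic j p1" "homogeneous_harmonic j p2"
    and Y: "\<And>y. y \<in> sphere 0 1 \<Longrightarrow> Y y = of_real (p1 y) + \<i> * of_real (p2 y)"
    using spherical_harmonic_decompose[OF assms(12)] by metis
  define \<Phi> where "\<Phi> p \<delta> = (\<integral>w. p w * q ((g ** \<delta> ** transpose R) *v w) \<partial>sphere_measure)"
    for p :: "real ^ 'm \<Rightarrow> real" and \<delta>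
  define \<Psi> where "\<Psi> \<delta> = complex_of_real \<kappa> * (of_real (\<Phi> p1 \<delta>) + \<i> * of_real (\<Phi> p2 \<delta>))" for \<delta>

  \<comment> \<open>The integrand depends on \<open>\<delta>\<close> only, and it is a combination of two correlations of real
    harmonic forms.\<close>
  have integrand: "stiefel_harmonic n k j Y
      (R ** matrix_inv \<delta> ** matrix_inv g ** matrix_inv \<gamma> ** v0 n k r c) = \<Psi> \<delta>"
    if \<gamma>: "\<gamma> \<in> group_K' n k r" and \<delta>: "\<delta> \<in> axis_stabilizer e" for \<gamma> \<delta>
  proof -
    note orth = axis_stabilizer_orthogonal[OF \<delta>] group_K'_orthogonal[OF \<gamma>]
    define M where "M = g ** \<delta> ** transpose R"
    define N where "N = R ** transpose \<delta> ** transpose g ** transpose \<gamma>"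
    have M: "orthogonal_matrix M" and N: "orthogonal_matrix N"
      unfolding M_def N_def using orth g R by (auto intro!: orthogonal_matrix_mul)
    have "transpose N = \<gamma> ** M"
      by (simp only: N_def M_def matrix_transpose_mul transpose_transpose matrix_mul_assoc)
    then have yN: "y v* N = \<gamma> *v (M *v y)" for y
      by (metis transpose_matrix_vector matrix_vector_mul_assoc)
    have norm: "(norm (y v* (N ** v0 n k r c)))\<^sup>2 = partial_normsq (- S) (M *v y)" for y
    proof -
      have "(norm (y v* (N ** v0 n k r c)))\<^sup>2 = (norm ((y v* N) v* v0 n k r c))\<^sup>2"
        by (simp only: vector_matrix_mul_assoc)
      also have "\<dots> = partial_normsq (- S) (\<gamma> *v (M *v y))"
        unfolding d(3) yN coordinate_columns_norm[OF d(1)] d(2) ..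
      also have "\<dots> = partial_normsq (- S) (M *v y)"
        unfolding S_def by (rule group_K'_partial_normsq[OF \<gamma> r])
      finally show ?thesis .
    qed
    have int: "integrable sphere_measure (\<lambda>w. p w * q (M *v w))" if "homogeneous_harmonic j p" for p
      using that q by (auto simp: homogeneous_harmonic_def intro!: integrable_poly_fun poly_intros)
    have "(\<integral>y. Y y * of_real (jacobi_R \<rho> \<sigma> m (2 * partial_normsq (- S) (M *v y) - 1)) \<partial>sphere_measure)
      = (\<integral>y. of_real (p1 y * q (M *v y)) + \<i> * of_real (p2 y * q (M *v y)) \<partial>sphere_measure)"
    proof (intro Bochner_Integration.integral_cong refl)
      fix y :: "real ^ 'm" assume "y \<in> space sphere_measure"
      then have y: "y \<in> sphere 0 1" by simp
      then have "(M *v y) \<bullet> (M *v y) = 1"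
        unfolding orthogonal_matrix_inner[OF M] by (simp add: norm_eq_1)
      from q_sphere[OF this]
      show "Y y * of_real (jacobi_R \<rho> \<sigma> m (2 * partial_normsq (- S) (M *v y) - 1))
          = of_real (p1 y * q (M *v y)) + \<i> * of_real (p2 y * q (M *v y))"
        unfolding Y[OF y] by (simp add: algebra_simps)
    qed
    also have "\<dots> = of_real (\<Phi> p1 \<delta>) + \<i> * of_real (\<Phi> p2 \<delta>)"
      using int[OF p(1)] int[OF p(2)] unfolding \<Phi>_def M_def[symmetric]
      by (subst Bochner_Integration.integral_add) (auto simp del: of_real_mult)
    finally have "(\<integral>y. Y y * of_real (jacobi_R \<rho> \<sigma> m (2 * (norm (y v* (N ** v0 n k r c)))\<^sup>2 - 1)) \<partial>sphere_measure)
        = of_real (\<Phi> p1 \<delta>) + \<i> * of_real (\<Phi> p2 \<delta>)"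
      unfolding norm .
    moreover have "N ** v0 n k r c \<in> stiefel_manifold"
      unfolding d(3) by (rule coordinate_columns_stiefel[OF d(1) N])
    ultimately have "stiefel_harmonic n k j Y (N ** v0 n k r c) = \<Psi> \<delta>"
      using assms(13,14) by (simp add: stiefel_harmonic_def \<Psi>_def \<kappa>_def m_def)
    then show ?thesis
      using orth g by (simp add: N_def matrix_inv_orthogonal)
  qed

  have prob: "prob_space \<mu>'" "prob_space \<mu>"
    using assms(8,9) by (simp_all add: haar_prob_measure_def)
  note corr = stabilizer_mean_of_correlation[OF card n _ q R(1) g haar, folded \<Phi>_def]
  have "dual_bispherical_mean n k r c \<mu>' \<mu> rot \<tau> (stiefel_harmonic n k j Y :: real ^ 'l ^ 'm \<Rightarrow> complex) x
      = (\<integral>(\<gamma>, \<delta>). \<Psi> \<delta> \<partial>(\<mu>' \<Otimes>\<^sub>M \<mu>))"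
    unfolding dual_bispherical_mean_def R_def[symmetric] g_def[symmetric]
    using integrand by (intro Bochner_Integration.integral_cong refl)
      (auto simp: space_pair_measure space_haar[OF haar] space_haar[OF assms(8)])
  also have "\<dots> = (\<integral>\<delta>. \<Psi> \<delta> \<partial>\<mu>)"
    using corr(1)[OF p(1)] corr(1)[OF p(2)] prob
    by (intro prob_space.integral_pair_snd) (auto simp: \<Psi>_def[abs_def] dest!: borel_measurable_integrable)
  also have "\<dots> = of_real \<kappa> * (of_real (\<integral>\<delta>. \<Phi> p1 \<delta> \<partial>\<mu>) + \<i> * of_real (\<integral>\<delta>. \<Phi> p2 \<delta> \<partial>\<mu>))"
    using corr(1)[OF p(1)] corr(1)[OF p(2)] by (simp add: \<Psi>_def)
  also have "\<dots> = of_real (\<kappa> * q (g *v axis e 1) / harmonics_dim n j) * (of_real (p1 x) + \<i> * of_real (p2 x))"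
    unfolding corr(2)[OF p(1)] corr(2)[OF p(2)] R(2) by (simp add: algebra_simps add_divide_distrib)
  also have "of_real (p1 x) + \<i> * of_real (p2 x) = Y x"
    by (rule Y[OF assms(15), symmetric])
  also have "q (g *v axis e 1) = jacobi_R \<rho> \<sigma> m (2 * \<tau>\<^sup>2 - 1)"
  proof -
    have "(g *v axis e 1) \<bullet> (g *v axis e 1) = 1"
      unfolding orthogonal_matrix_inner[OF g] by (simp add: inner_axis_axis)
    moreover have "partial_normsq (- S) (g *v axis e 1) = \<tau>\<^sup>2"
    proof -
      have "e \<notin> S"
        using inj_on_image_mem_iff[OF injr, of "n + 1" "{1..k + 1}"] kn by (simp add: S_def e_def)
      have "r (k + 1) \<in> S" by (simp add: S_def)
      have "partial_normsq (- S) (g *v axis e 1) = (\<Sum>a\<in>- S. if a = e then \<tau>\<^sup>2 else 0)"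
        unfolding partial_normsq_def
      proof (intro sum.cong refl)
        fix a assume "a \<in> - S"
        then have "a \<noteq> r (k + 1)" using \<open>r (k + 1) \<in> S\<close> by auto
        then show "(g *v axis e 1) $ a * (g *v axis e 1) $ a = (if a = e then \<tau>\<^sup>2 else 0)"
          unfolding g_givens givens_nth[OF ne]
          using assms(6,7) ne by (auto simp: power2_eq_square axis_def)
      qed
      then show ?thesis using \<open>e \<notin> S\<close> by simp
    qed
    ultimately show ?thesis by (simp add: q_sphere)
  qed
  also have "\<kappa> * jacobi_R \<rho> \<sigma> m (2 * \<tau>\<^sup>2 - 1) / harmonics_dim n j
      = varkappa n k j / sqrt (harmonics_dim n j) * jacobi_R \<rho> \<sigma> (j div 2) (2 * \<tau>\<^sup>2 - 1)"
  proof -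
    define s where "s = sqrt (harmonics_dim n j)"
    have "s \<noteq> 0" "harmonics_dim n j = s * s"
      using harmonics_dim_pos[OF n, of j] by (simp_all add: s_def)
    then have "varkappa n k j * s * J / harmonics_dim n j = varkappa n k j / s * J" for J
      by simp
    then show ?thesis unfolding \<kappa>_def m_def s_def .
  qed
  finally show ?thesis .
qed

end
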